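(* Let $[U;S_1,S_2]$ be a pomonoid amalgam. If $U$ is strongly pounitary in both $S_1$ and $S_2$, then the amalgam is strongly poembeddable and $U$ has the poextension property in $S_1\ast_U S_2$.
   Context: A pomonoid is a monoid $S$ with a partial order $\le$ such that $t\le u$ implies $st\le su$ and $ts\le us$. A subpomonoid is a submonoid with the induced order. An order embedding is a map $f$ of posets with $x\le y\Leftrightarrow f(x)\le f(y)$; a pomonoid order embedding is a monoid homomorphism that is an order embedding. A pomonoid amalgam $[U;S_1,S_2]$ consists of pomonoids $U,S_1,S_2$ and pomonoid order embeddings $\varphi_i:U\to S_i$, via which $U$ is regarded as a subpomonoid of each $S_i$. It is strongly poembeddable if there are a pomonoid $W$ and pomonoid order embeddings $\theta_i:S_i\to W$ with $\theta_1\varphi_1=\theta_2\varphi_2$ and $\theta_1(S_1)\cap\theta_2(S_2)=\theta_1\varphi_1(U)$. The amalgamated free product $S_1\ast_U S_2$ is the pushout of $\varphi_1,\varphi_2$ in the category of pomonoids and monotone monoid homomorphisms; $U$ is identified with its image in it. A subpomonoid $U$ of a pomonoid $S$ is strongly right pounitary in $S$ if for all $u,v\in U$, $s\in S$: ($v\le su$ or $su\le v$) implies $s\in U$; strongly left pounitary is the dual ($v\le us$ or $us\le v$ implies $s\in U$); strongly pounitary means both. A right $U$-poset is a nonempty poset $A$ that is a right $U$-act such that $a\le b$ implies $as\le bs$ and $s\le t$ implies $as\le at$; left $U$-posets are dual. For a right $U$-poset $A$ and a left $U$-poset $B$, $A\otimes_U B$ is the quotient of the poset $A\times B$ (componentwise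 order) by the order-congruence generated by the pairs $((au,b),(a,ub))$; explicitly, $a\otimes b\le a'\otimes b'$ iff there exist $n\ge1$, $a_1,\dots,a_n\in A$, $b_1=b,b_2,\dots,b_n,b_{n+1}=b'\in B$, $u_i,v_i\in U$ with $a\le a_1u_1$, $a_iv_i\le a_{i+1}u_{i+1}$ ($1\le i<n$), $a_nv_n\le a'$, and $u_ib_i\le v_ib_{i+1}$ ($1\le i\le n$). $U$ has the poextension property in a pomonoid $S$ containing it if for every right $U$-poset $X$ and left $U$-poset $Y$ the map $X\otimes_U Y\to X\otimes_U S\otimes_U Y$, $x\otimes y\mapsto x\otimes1\otimes y$, is an order embedding. *)

theory Defs
  imports "HOL-Algebra.Group"
begin

section \<open>Pomonoids and pomonoid amalgams\<close>

record 'a pomonoid = "'a monoid" +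
  leq :: "('a \<times> 'a) set"

locale pomonoid = monoid S for S :: "('a, 'm) pomonoid_scheme" (structure) +
  assumes partial_order: "partial_order_on (carrier S) (leq S)"
    and mult_mono_right: "\<lbrakk>s \<in> carrier S; (t, u) \<in> leq S\<rbrakk> \<Longrightarrow> (s \<otimes> t, s \<otimes> u) \<in> leq S"
    and mult_mono_left: "\<lbrakk>s \<in> carrier S; (t, u) \<in> leq S\<rbrakk> \<Longrightarrow> (t \<otimes> s, u \<otimes> s) \<in> leq S"

definition pomonoid_hom ::
  "('a, 'm) pomonoid_scheme \<Rightarrow> ('b, 'n) pomonoid_scheme \<Rightarrow> ('a \<Rightarrow> 'b) set" where
  "pomonoid_hom S T = {h \<in> hom S T. h \<one>\<^bsub>S\<^esub> = \<one>\<^bsub>T\<^esub> \<and>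
     (\<forall>x y. (x, y) \<in> leq S \<longrightarrow> (h x, h y) \<in> leq T)}"

definition order_embedding ::
  "'a set \<Rightarrow> ('a \<times> 'a) set \<Rightarrow> 'b set \<Rightarrow> ('b \<times> 'b) set \<Rightarrow> ('a \<Rightarrow> 'b) \<Rightarrow> bool" where
  "order_embedding A r B s f \<longleftrightarrow>
     f \<in> A \<rightarrow> B \<and> (\<forall>x\<in>A. \<forall>y\<in>A. (x, y) \<in> r \<longleftrightarrow> (f x, f y) \<in> s)"

definition pomonoid_embedding ::
  "('a, 'm) pomonoid_scheme \<Rightarrow> ('b, 'n) pomonoid_scheme \<Rightarrow> ('a \<Rightarrow> 'b) \<Rightarrow> bool" where
  "pomonoid_embedding S T f \<longleftrightarrow> f \<in> hom S T \<and> f \<one>\<^bsub>S\<^esub> = \<one>\<^bsub>T\<^esub> \<and>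
     order_embedding (carrier S) (leq S) (carrier T) (leq T) f"

locale pomonoid_amalgam =
  U: pomonoid U + S1: pomonoid S1 + S2: pomonoid S2
  for U :: "'u pomonoid" and S1 :: "'a pomonoid" and S2 :: "'b pomonoid" +
  fixes \<phi>1 :: "'u \<Rightarrow> 'a" and \<phi>2 :: "'u \<Rightarrow> 'b"
  assumes embedding1: "pomonoid_embedding U S1 \<phi>1"
    and embedding2: "pomonoid_embedding U S2 \<phi>2"

definition strongly_poembeddable_in ::
  "'w itself \<Rightarrow> 'u pomonoid \<Rightarrow> 'a pomonoid \<Rightarrow> 'b pomonoid \<Rightarrow> ('u \<Rightarrow> 'a) \<Rightarrow> ('u \<Rightarrow> 'b) \<Rightarrow> bool" where
  "strongly_poembeddable_in TYPE('w) U S1 S2 \<phi>1 \<phi>2 \<longleftrightarrow>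
     (\<exists>(W :: 'w pomonoid) \<theta>1 \<theta>2. pomonoid W \<and>
        pomonoid_embedding S1 W \<theta>1 \<and> pomonoid_embedding S2 W \<theta>2 \<and>
        (\<forall>u\<in>carrier U. \<theta>1 (\<phi>1 u) = \<theta>2 (\<phi>2 u)) \<and>
        \<theta>1 ` carrier S1 \<inter> \<theta>2 ` carrier S2 = \<theta>1 ` \<phi>1 ` carrier U)"

text \<open>
  The carrier type of the witness \<open>W\<close> has to be fixed. Sets of words over the disjoint union of the
  two pomonoids lose no generality: see \<open>strongly_poembeddable_inD\<close> below.
\<close>
definition strongly_poembeddable ::
  "'u pomonoid \<Rightarrow> 'a pomonoid \<Rightarrow> 'b pomonoid \<Rightarrow> ('u \<Rightarrow> 'a) \<Rightarrow> ('u \<Rightarrow> 'b) \<Rightarrow> bool" where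
  "strongly_poembeddable = strongly_poembeddable_in TYPE(('a + 'b) list set)"

definition pushout_wrt ::
  "'w itself \<Rightarrow> 'u pomonoid \<Rightarrow> 'a pomonoid \<Rightarrow> 'b pomonoid \<Rightarrow> ('u \<Rightarrow> 'a) \<Rightarrow> ('u \<Rightarrow> 'b) \<Rightarrow>
   'p pomonoid \<Rightarrow> ('a \<Rightarrow> 'p) \<Rightarrow> ('b \<Rightarrow> 'p) \<Rightarrow> bool" where
  "pushout_wrt TYPE('w) U S1 S2 \<phi>1 \<phi>2 P \<iota>1 \<iota>2 \<longleftrightarrow>
     pomonoid P \<and> \<iota>1 \<in> pomonoid_hom S1 P \<and> \<iota>2 \<in> pomonoid_hom S2 P \<and>
     (\<forall>u\<in>carrier U. \<iota>1 (\<phi>1 u) = \<iota>2 (\<phi>2 u)) \<and>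
     (\<forall>(W :: 'w pomonoid) f1 f2.
        pomonoid W \<and> f1 \<in> pomonoid_hom S1 W \<and> f2 \<in> pomonoid_hom S2 W \<and>
        (\<forall>u\<in>carrier U. f1 (\<phi>1 u) = f2 (\<phi>2 u)) \<longrightarrow>
        (\<exists>h\<in>pomonoid_hom P W.
           (\<forall>x\<in>carrier S1. h (\<iota>1 x) = f1 x) \<and> (\<forall>y\<in>carrier S2. h (\<iota>2 y) = f2 y) \<and>
           (\<forall>h'\<in>pomonoid_hom P W.
              (\<forall>x\<in>carrier S1. h' (\<iota>1 x) = f1 x) \<and> (\<forall>y\<in>carrier S2. h' (\<iota>2 y) = f2 y) \<longrightarrow>
              (\<forall>p\<in>carrier P. h' p = h p))))"

text \<open>
  A pushout has the universal property against pomonoids of every type. A formula can only test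
  against fixed types; testing against the type of \<open>P\<close> itself and against sets of words already
  implies the property for all types (\<open>amalgamated_free_product_pushout\<close> below), and a
  pushout carried by sets of words exists (\<open>amalgamated_free_product_exists\<close>).
\<close>
definition amalgamated_free_product ::
  "'u pomonoid \<Rightarrow> 'a pomonoid \<Rightarrow> 'b pomonoid \<Rightarrow> ('u \<Rightarrow> 'a) \<Rightarrow> ('u \<Rightarrow> 'b) \<Rightarrow>
   'p pomonoid \<Rightarrow> ('a \<Rightarrow> 'p) \<Rightarrow> ('b \<Rightarrow> 'p) \<Rightarrow> bool" where
  "amalgamated_free_product U S1 S2 \<phi>1 \<phi>2 (P :: 'p pomonoid) \<iota>1 \<iota>2 \<longleftrightarrow>
     pushout_wrt TYPE('p) U S1 S2 \<phi>1 \<phi>2 P \<iota>1 \<iota>2 \<and>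
     pushout_wrt TYPE(('a + 'b) list set) U S1 S2 \<phi>1 \<phi>2 P \<iota>1 \<iota>2"

definition strongly_right_pounitary :: "'a set \<Rightarrow> ('a, 'm) pomonoid_scheme \<Rightarrow> bool" where
  "strongly_right_pounitary V S \<longleftrightarrow> submonoid V S \<and>
     (\<forall>u\<in>V. \<forall>v\<in>V. \<forall>s\<in>carrier S.
        (v, s \<otimes>\<^bsub>S\<^esub> u) \<in> leq S \<or> (s \<otimes>\<^bsub>S\<^esub> u, v) \<in> leq S \<longrightarrow> s \<in> V)"

definition strongly_left_pounitary :: "'a set \<Rightarrow> ('a, 'm) pomonoid_scheme \<Rightarrow> bool" where
  "strongly_left_pounitary V S \<longleftrightarrow> submonoid V S \<and>
     (\<forall>u\<in>V. \<forall>v\<in>V. \<forall>s\<in>carrier S.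
        (v, u \<otimes>\<^bsub>S\<^esub> s) \<in> leq S \<or> (u \<otimes>\<^bsub>S\<^esub> s, v) \<in> leq S \<longrightarrow> s \<in> V)"

definition strongly_pounitary :: "'a set \<Rightarrow> ('a, 'm) pomonoid_scheme \<Rightarrow> bool" where
  "strongly_pounitary V S \<longleftrightarrow> strongly_right_pounitary V S \<and> strongly_left_pounitary V S"


section \<open>Posets with an action, tensor products, poextension\<close>

record ('a, 'u) right_act_poset = "'a partial_object" +
  rleq :: "('a \<times> 'a) set"
  ract :: "'a \<Rightarrow> 'u \<Rightarrow> 'a"

record ('a, 'u) left_act_poset = "'a partial_object" +
  lleq :: "('a \<times> 'a) set"
  lact :: "'u \<Rightarrow> 'a \<Rightarrow> 'a"

locale right_poset =
  fixes U :: "('u, 'm) pomonoid_scheme" and A :: "('a, 'u) right_act_poset"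
  assumes nonempty: "carrier A \<noteq> {}"
    and partial_order: "partial_order_on (carrier A) (rleq A)"
    and act_closed: "\<lbrakk>a \<in> carrier A; u \<in> carrier U\<rbrakk> \<Longrightarrow> ract A a u \<in> carrier A"
    and act_one: "a \<in> carrier A \<Longrightarrow> ract A a \<one>\<^bsub>U\<^esub> = a"
    and act_mult: "\<lbrakk>a \<in> carrier A; u \<in> carrier U; v \<in> carrier U\<rbrakk> \<Longrightarrow>
      ract A a (u \<otimes>\<^bsub>U\<^esub> v) = ract A (ract A a u) v"
    and act_mono_left: "\<lbrakk>(a, b) \<in> rleq A; u \<in> carrier U\<rbrakk> \<Longrightarrow> (ract A a u, ract A b u) \<in> rleq A"
    and act_mono_right: "\<lbrakk>a \<in> carrier A; (u, v) \<in> leq U\<rbrakk> \<Longrightarrow> (ract A a u, ract A a v) \<in> rleq A"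

locale left_poset =
  fixes U :: "('u, 'm) pomonoid_scheme" and A :: "('a, 'u) left_act_poset"
  assumes nonempty: "carrier A \<noteq> {}"
    and partial_order: "partial_order_on (carrier A) (lleq A)"
    and act_closed: "\<lbrakk>a \<in> carrier A; u \<in> carrier U\<rbrakk> \<Longrightarrow> lact A u a \<in> carrier A"
    and act_one: "a \<in> carrier A \<Longrightarrow> lact A \<one>\<^bsub>U\<^esub> a = a"
    and act_mult: "\<lbrakk>a \<in> carrier A; u \<in> carrier U; v \<in> carrier U\<rbrakk> \<Longrightarrow>
      lact A (u \<otimes>\<^bsub>U\<^esub> v) a = lact A u (lact A v a)"
    and act_mono_right: "\<lbrakk>(a, b) \<in> lleq A; u \<in> carrier U\<rbrakk> \<Longrightarrow> (lact A u a, lact A u b) \<in> lleq A"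
    and act_mono_left: "\<lbrakk>a \<in> carrier A; (u, v) \<in> leq U\<rbrakk> \<Longrightarrow> (lact A u a, lact A v a) \<in> lleq A"

definition tensor_gens ::
  "('u, 'm) pomonoid_scheme \<Rightarrow> ('a, 'u) right_act_poset \<Rightarrow> ('b, 'u) left_act_poset \<Rightarrow>
   (('a \<times> 'b) \<times> ('a \<times> 'b)) set" where
  "tensor_gens U A B =
     {((ract A a u, b), (a, lact B u b)) | a u b. a \<in> carrier A \<and> u \<in> carrier U \<and> b \<in> carrier B}"

text \<open>
  The preorder on \<open>A \<times> B\<close> generated by the componentwise order and by the generating pairs in both
  directions; \<open>A \<otimes> B\<close> is its poset of classes. Lemma \<open>tensor_preorder_iff_scheme\<close> below unfolds it
  into the usual explicit scheme of inequalities.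
\<close>
definition tensor_preorder ::
  "('u, 'm) pomonoid_scheme \<Rightarrow> ('a, 'u) right_act_poset \<Rightarrow> ('b, 'u) left_act_poset \<Rightarrow>
   (('a \<times> 'b) \<times> ('a \<times> 'b)) set" where
  "tensor_preorder U A B =
     ({((a, b), (a', b')). (a, a') \<in> rleq A \<and> (b, b') \<in> lleq B} \<union>
      tensor_gens U A B \<union> (tensor_gens U A B)\<inverse>)\<^sup>+"

definition tensor_class ::
  "('u, 'm) pomonoid_scheme \<Rightarrow> ('a, 'u) right_act_poset \<Rightarrow> ('b, 'u) left_act_poset \<Rightarrow>
   'a \<Rightarrow> 'b \<Rightarrow> ('a \<times> 'b) set" where
  "tensor_class U A B a b =
     {q. ((a, b), q) \<in> tensor_preorder U A B \<and> (q, (a, b)) \<in> tensor_preorder U A B}"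

definition tensor_carrier ::
  "('u, 'm) pomonoid_scheme \<Rightarrow> ('a, 'u) right_act_poset \<Rightarrow> ('b, 'u) left_act_poset \<Rightarrow>
   ('a \<times> 'b) set set" where
  "tensor_carrier U A B = {tensor_class U A B a b | a b. a \<in> carrier A \<and> b \<in> carrier B}"

definition tensor_leq ::
  "('u, 'm) pomonoid_scheme \<Rightarrow> ('a, 'u) right_act_poset \<Rightarrow> ('b, 'u) left_act_poset \<Rightarrow>
   (('a \<times> 'b) set \<times> ('a \<times> 'b) set) set" where
  "tensor_leq U A B =
     {(tensor_class U A B a b, tensor_class U A B a' b') | a b a' b'.
        ((a, b), (a', b')) \<in> tensor_preorder U A B}"

text \<open>\<open>S\<close> as a left \<open>U\<close>-poset by restricting scalars along \<open>f\<close>.\<close>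
definition restrict_left :: "('u \<Rightarrow> 's) \<Rightarrow> ('s, 'm) pomonoid_scheme \<Rightarrow> ('s, 'u) left_act_poset" where
  "restrict_left f S = \<lparr>carrier = carrier S, lleq = leq S, lact = (\<lambda>u s. f u \<otimes>\<^bsub>S\<^esub> s)\<rparr>"

text \<open>
  \<open>X \<otimes> S\<close> as a right \<open>U\<close>-poset, with \<open>(x \<otimes> s) u = x \<otimes> s (f u)\<close>. The union is over classes that
  all coincide (\<open>tensor_ext_act\<close>).
\<close>
definition tensor_ext ::
  "('u, 'n) pomonoid_scheme \<Rightarrow> ('x, 'u) right_act_poset \<Rightarrow> ('u \<Rightarrow> 's) \<Rightarrow> ('s, 'm) pomonoid_scheme \<Rightarrow>
   (('x \<times> 's) set, 'u) right_act_poset" where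
  "tensor_ext U X f S =
     \<lparr>carrier = tensor_carrier U X (restrict_left f S),
      rleq = tensor_leq U X (restrict_left f S),
      ract = (\<lambda>C u. \<Union>(x, s)\<in>C. tensor_class U X (restrict_left f S) x (s \<otimes>\<^bsub>S\<^esub> f u))\<rparr>"

text \<open>The map \<open>x \<otimes> y \<mapsto> (x \<otimes> 1) \<otimes> y\<close> (\<open>poext_map_class\<close>).\<close>
definition poext_map ::
  "('u, 'n) pomonoid_scheme \<Rightarrow> ('x, 'u) right_act_poset \<Rightarrow> ('u \<Rightarrow> 's) \<Rightarrow> ('s, 'm) pomonoid_scheme \<Rightarrow>
   ('y, 'u) left_act_poset \<Rightarrow> ('x \<times> 'y) set \<Rightarrow> (('x \<times> 's) set \<times> 'y) set" where
  "poext_map U X f S Y C =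
     (\<Union>(x, y)\<in>C. tensor_class U (tensor_ext U X f S) Y
        (tensor_class U X (restrict_left f S) x \<one>\<^bsub>S\<^esub>) y)"

text \<open>
  \<open>U\<close> is contained in \<open>S\<close> via the embedding \<open>f\<close>. The \<open>U\<close>-posets range over all those carried by
  the types \<open>'x\<close> and \<open>'y\<close>, so a statement that is polymorphic in \<open>'x\<close> and \<open>'y\<close> covers
  all \<open>U\<close>-posets.
\<close>
definition poextension_property ::
  "'x itself \<Rightarrow> 'y itself \<Rightarrow> 'u pomonoid \<Rightarrow> ('u \<Rightarrow> 's) \<Rightarrow> 's pomonoid \<Rightarrow> bool" where
  "poextension_property TYPE('x) TYPE('y) U f S \<longleftrightarrow>
     pomonoid_embedding U S f \<and>
     (\<forall>(X :: ('x, 'u) right_act_poset) (Y :: ('y, 'u) left_act_poset).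
        right_poset U X \<and> left_poset U Y \<longrightarrow>
        order_embedding (tensor_carrier U X Y) (tensor_leq U X Y)
          (tensor_carrier U (tensor_ext U X f S) Y) (tensor_leq U (tensor_ext U X f S) Y)
          (poext_map U X f S Y))"

subsection \<open>The explicit scheme and the well-definedness of the constructions\<close>

definition tensor_scheme ::
  "('u, 'm) pomonoid_scheme \<Rightarrow> ('a, 'u) right_act_poset \<Rightarrow> ('b, 'u) left_act_poset \<Rightarrow>
   'a \<times> 'b \<Rightarrow> 'a \<times> 'b \<Rightarrow> bool" where
  "tensor_scheme U A B = (\<lambda>(a, b) (a', b').
     \<exists>(n::nat) as bs us vs. n \<ge> 1 \<and>
       (\<forall>i\<in>{1..n}. as i \<in> carrier A \<and> us i \<in> carrier U \<and> vs i \<in> carrier U) \<and>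
       (\<forall>i\<in>{1..n + 1}. bs i \<in> carrier B) \<and> bs 1 = b \<and> bs (n + 1) = b' \<and>
       (a, ract A (as 1) (us 1)) \<in> rleq A \<and>
       (\<forall>i\<in>{1..<n}. (ract A (as i) (vs i), ract A (as (i + 1)) (us (i + 1))) \<in> rleq A) \<and>
       (ract A (as n) (vs n), a') \<in> rleq A \<and>
       (\<forall>i\<in>{1..n}. (lact B (us i) (bs i), lact B (vs i) (bs (i + 1))) \<in> lleq B))"

lemma trancl_map:
  assumes "(p, q) \<in> R\<^sup>+" and "trans S" and "\<And>p q. (p, q) \<in> R \<Longrightarrow> (g p, g q) \<in> S"
  shows "(g p, g q) \<in> S"
  using assms(1) by (induction rule: trancl_induct) (use assms(2,3) in \<open>blast dest: transD\<close>)+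

locale tensor_pair = U: pomonoid U + A: right_poset U A + B: left_poset U B
  for U :: "('u, 'm) pomonoid_scheme" and A :: "('a, 'u) right_act_poset"
    and B :: "('b, 'u) left_act_poset"
begin

lemma A_order: "rleq A \<subseteq> carrier A \<times> carrier A" "a \<in> carrier A \<Longrightarrow> (a, a) \<in> rleq A"
  "(a, b) \<in> rleq A \<Longrightarrow> (b, c) \<in> rleq A \<Longrightarrow> (a, c) \<in> rleq A"
  using A.partial_order
  by (auto simp: partial_order_on_def preorder_on_def refl_on_def dest: transD)

lemma B_order: "lleq B \<subseteq> carrier B \<times> carrier B" "a \<in> carrier B \<Longrightarrow> (a, a) \<in> lleq B"
  "(a, b) \<in> lleq B \<Longrightarrow> (b, c) \<in> lleq B \<Longrightarrow> (a, c) \<in> lleq B"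
  using B.partial_order
  by (auto simp: partial_order_on_def preorder_on_def refl_on_def dest: transD)

lemma tensor_preorder_dom:
  "tensor_preorder U A B \<subseteq> (carrier A \<times> carrier B) \<times> (carrier A \<times> carrier B)"
  unfolding tensor_preorder_def tensor_gens_def
  by (rule trancl_subset_Sigma)
    (use A_order(1) B_order(1) A.act_closed B.act_closed in auto)

lemma tensor_preorder_trans: "trans (tensor_preorder U A B)"
  unfolding tensor_preorder_def by (rule trans_trancl)

lemma tensor_preorder_comp:
  "(a, a') \<in> rleq A \<Longrightarrow> (b, b') \<in> lleq B \<Longrightarrow> ((a, b), (a', b')) \<in> tensor_preorder U A B"
  unfolding tensor_preorder_def by blast

lemma tensor_preorder_refl:
  "a \<in> carrier A \<Longrightarrow> b \<in> carrier B \<Longrightarrow> ((a, b), (a, b)) \<in> tensor_preorder U A B"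
  by (rule tensor_preorder_comp) (auto intro: A_order B_order)

lemma tensor_preorder_move:
  assumes "a \<in> carrier A" "b \<in> carrier B" "u \<in> carrier U"
  shows "((ract A a u, b), (a, lact B u b)) \<in> tensor_preorder U A B"
    and "((a, lact B u b), (ract A a u, b)) \<in> tensor_preorder U A B"
  using assms unfolding tensor_preorder_def tensor_gens_def
  by (blast intro!: r_into_trancl)+

lemma tensor_schemeI_single:
  assumes "c \<in> carrier A" "u \<in> carrier U" "v \<in> carrier U" "b \<in> carrier B" "b' \<in> carrier B"
    and "(a, ract A c u) \<in> rleq A" "(ract A c v, a') \<in> rleq A" "(lact B u b, lact B v b') \<in> lleq B"
  shows "tensor_scheme U A B (a, b) (a', b')"
  unfolding tensor_scheme_def split
  by (rule exI[of _ 1], rule exI[of _ "\<lambda>_. c"], rule exI[of _ "\<lambda>i. if i = 1 then b else b'"],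
      rule exI[of _ "\<lambda>_. u"], rule exI[of _ "\<lambda>_. v"]) (use assms in auto)

lemma tensor_scheme_trans:
  assumes "tensor_scheme U A B p q" "tensor_scheme U A B q r"
  shows "tensor_scheme U A B p r"
proof -
  obtain a b a' b' a'' b'' where pqr: "p = (a, b)" "q = (a', b')" "r = (a'', b'')"
    by (metis surj_pair)
  obtain n as bs us vs where 1: "n \<ge> (1::nat)"
      "\<forall>i\<in>{1..n}. as i \<in> carrier A \<and> us i \<in> carrier U \<and> vs i \<in> carrier U"
      "\<forall>i\<in>{1..n + 1}. bs i \<in> carrier B" "bs 1 = b" "bs (n + 1) = b'"
      "(a, ract A (as 1) (us 1)) \<in> rleq A"
      "\<forall>i\<in>{1..<n}. (ract A (as i) (vs i), ract A (as (i + 1)) (us (i + 1))) \<in> rleq A"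
      "(ract A (as n) (vs n), a') \<in> rleq A"
      "\<forall>i\<in>{1..n}. (lact B (us i) (bs i), lact B (vs i) (bs (i + 1))) \<in> lleq B"
    using assms(1) unfolding pqr tensor_scheme_def split by blast
  obtain m as' bs' us' vs' where 2: "m \<ge> (1::nat)"
      "\<forall>i\<in>{1..m}. as' i \<in> carrier A \<and> us' i \<in> carrier U \<and> vs' i \<in> carrier U"
      "\<forall>i\<in>{1..m + 1}. bs' i \<in> carrier B" "bs' 1 = b'" "bs' (m + 1) = b''"
      "(a', ract A (as' 1) (us' 1)) \<in> rleq A"
      "\<forall>i\<in>{1..<m}. (ract A (as' i) (vs' i), ract A (as' (i + 1)) (us' (i + 1))) \<in> rleq A"
      "(ract A (as' m) (vs' m), a'') \<in> rleq A"
      "\<forall>i\<in>{1..m}. (lact B (us' i) (bs' i), lact B (vs' i) (bs' (i + 1))) \<in> lleq B"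
    using assms(2) unfolding pqr tensor_scheme_def split by blast
  let ?as = "\<lambda>i. if i \<le> n then as i else as' (i - n)"
  let ?us = "\<lambda>i. if i \<le> n then us i else us' (i - n)"
  let ?vs = "\<lambda>i. if i \<le> n then vs i else vs' (i - n)"
  let ?bs = "\<lambda>i. if i \<le> n then bs i else bs' (i - n)"
  have A: "(ract A (?as i) (?vs i), ract A (?as (i + 1)) (?us (i + 1))) \<in> rleq A"
    if i: "i \<in> {1..<n + m}" for i
  proof -
    consider "i < n" | "i = n" | "i > n" by linarith
    then show ?thesis
    proof cases
      case 1
      then show ?thesis using \<open>\<forall>i\<in>{1..<n}. _ i\<close> i by auto
    next
      case 2
      then show ?thesis using A_order(3)[OF 1(8) \<open>(a', _) \<in> rleq A\<close>] by simp
    next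
      case 3
      then have "i - n \<in> {1..<m}" "i + 1 - n = (i - n) + 1" using i by auto
      then show ?thesis using 3 bspec[OF 2(7), of "i - n"] by simp
    qed
  qed
  have B: "(lact B (?us i) (?bs i), lact B (?vs i) (?bs (i + 1))) \<in> lleq B"
    if i: "i \<in> {1..n + m}" for i
  proof -
    consider "i < n" | "i = n" | "i > n" by linarith
    then show ?thesis
    proof cases
      case 1
      then show ?thesis using \<open>\<forall>i\<in>{1..n}. (lact B _ _, _) \<in> _\<close> i by auto
    next
      case 2
      then show ?thesis using bspec[OF 1(9), of n] 1(1,5) 2 \<open>bs' 1 = b'\<close> by simp
    next
      case 3
      then have "i - n \<in> {1..m}" "i + 1 - n = (i - n) + 1" using i by auto
      then show ?thesis using 3 bspec[OF 2(9), of "i - n"] by simp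
    qed
  qed
  have C: "\<forall>i\<in>{1..n + m}. ?as i \<in> carrier A \<and> ?us i \<in> carrier U \<and> ?vs i \<in> carrier U"
  proof
    fix i assume "i \<in> {1..n + m}"
    then show "?as i \<in> carrier A \<and> ?us i \<in> carrier U \<and> ?vs i \<in> carrier U"
      using bspec[OF 1(2), of i] bspec[OF 2(2), of "i - n"]
      by (cases "i \<le> n") (simp_all add: Suc_le_eq le_diff_conv add.commute)
  qed
  have D: "\<forall>i\<in>{1..n + m + 1}. ?bs i \<in> carrier B"
  proof
    fix i assume "i \<in> {1..n + m + 1}"
    then show "?bs i \<in> carrier B"
      using bspec[OF 1(3), of i] bspec[OF 2(3), of "i - n"]
      by (cases "i \<le> n") (simp_all add: Suc_le_eq le_diff_conv add.commute)
  qed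
  show ?thesis
    unfolding pqr tensor_scheme_def split
    by (rule exI[of _ "n + m"], rule exI[of _ ?as], rule exI[of _ ?bs], rule exI[of _ ?us],
        rule exI[of _ ?vs])
      (use 1 2 A B C D in \<open>simp add: Suc_diff_le\<close>)
qed

theorem tensor_preorder_iff_scheme:
  "(p, q) \<in> tensor_preorder U A B \<longleftrightarrow> tensor_scheme U A B p q"
proof
  assume "(p, q) \<in> tensor_preorder U A B"
  then show "tensor_scheme U A B p q"
  proof -
    have "trans {(p, q). tensor_scheme U A B p q}"
      using tensor_scheme_trans by (blast intro: transI)
    moreover have "tensor_scheme U A B p q"
      if "(p, q) \<in> {((a, b), (a', b')). (a, a') \<in> rleq A \<and> (b, b') \<in> lleq B} \<union>
        tensor_gens U A B \<union> (tensor_gens U A B)\<inverse>" for p q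
    proof -
      obtain a b a' b' where pq: "p = (a, b)" "q = (a', b')" by (metis surj_pair)
      consider (le) "(a, a') \<in> rleq A" "(b, b') \<in> lleq B"
        | (gen) u where "a' \<in> carrier A" "u \<in> carrier U" "b \<in> carrier B" "a = ract A a' u" "b' = lact B u b"
        | (neg) u where "a \<in> carrier A" "u \<in> carrier U" "b' \<in> carrier B" "a' = ract A a u" "b = lact B u b'"
        using \<open>(p, q) \<in> _\<close> unfolding pq tensor_gens_def by auto
      then show ?thesis
      proof cases
        case le
        then have "a \<in> carrier A" "b \<in> carrier B" "b' \<in> carrier B"
          using A_order(1) B_order(1) by auto
        with le show ?thesis unfolding pq
          by (intro tensor_schemeI_single[of a "\<one>\<^bsub>U\<^esub>" "\<one>\<^bsub>U\<^esub>"])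
            (auto simp: A.act_one B.act_one A_order)
      next
        case gen
        then show ?thesis unfolding pq
          by (intro tensor_schemeI_single[of a' u "\<one>\<^bsub>U\<^esub>"])
            (auto simp: A.act_one B.act_one A.act_closed B.act_closed A_order B_order)
      next
        case neg
        then show ?thesis unfolding pq
          by (intro tensor_schemeI_single[of a "\<one>\<^bsub>U\<^esub>" u])
            (auto simp: A.act_one B.act_one A.act_closed B.act_closed A_order B_order)
      qed
    qed
    ultimately show ?thesis
      using \<open>(p, q) \<in> tensor_preorder U A B\<close> trancl_map[where g = "\<lambda>p. p"]
      unfolding tensor_preorder_def by (metis (no_types, lifting) mem_Collect_eq case_prodI case_prodD)
  qed
next
  assume "tensor_scheme U A B p q"
  moreover obtain a b a' b' where pq: "p = (a, b)" "q = (a', b')" by (metis surj_pair)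
  ultimately obtain n as bs us vs where 1: "n \<ge> (1::nat)"
      "\<forall>i\<in>{1..n}. as i \<in> carrier A \<and> us i \<in> carrier U \<and> vs i \<in> carrier U"
      "\<forall>i\<in>{1..n + 1}. bs i \<in> carrier B" "bs 1 = b" "bs (n + 1) = b'"
      "(a, ract A (as 1) (us 1)) \<in> rleq A"
      "\<forall>i\<in>{1..<n}. (ract A (as i) (vs i), ract A (as (i + 1)) (us (i + 1))) \<in> rleq A"
      "(ract A (as n) (vs n), a') \<in> rleq A"
      "\<forall>i\<in>{1..n}. (lact B (us i) (bs i), lact B (vs i) (bs (i + 1))) \<in> lleq B"
    unfolding tensor_scheme_def split by blast
  note tr = transD[OF tensor_preorder_trans]
  have turn: "((ract A (as i) (us i), bs i), (ract A (as i) (vs i), bs (i + 1))) \<in> tensor_preorder U A B"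
    if i: "i \<in> {1..n}" for i
  proof -
    have c: "as i \<in> carrier A" "us i \<in> carrier U" "vs i \<in> carrier U" "bs i \<in> carrier B"
      "bs (i + 1) \<in> carrier B"
      using i 1(2,3) by auto
    show ?thesis
      by (rule tr[OF tensor_preorder_move(1)[OF c(1,4,2)]
            tr[OF tensor_preorder_comp tensor_preorder_move(2)[OF c(1,5,3)]]])
        (use i c 1(9) A_order in auto)
  qed
  have "((a, b), (ract A (as i) (vs i), bs (i + 1))) \<in> tensor_preorder U A B"
    if "i \<in> {1..n}" for i
    using that
  proof (induction i)
    case (Suc i)
    show ?case
    proof (cases "i = 0")
      case True
      have "((a, b), (ract A (as 1) (us 1), bs 1)) \<in> tensor_preorder U A B"
        using 1 by (intro tensor_preorder_comp) (auto intro: B_order)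
      from tr[OF this turn[of 1]] show ?thesis using True Suc.prems by simp
    next
      case False
      then have i: "i \<in> {1..<n}" "i \<in> {1..n}" "Suc i \<in> {1..n}" using Suc.prems by auto
      have "((ract A (as i) (vs i), bs (i + 1)), (ract A (as (i + 1)) (us (i + 1)), bs (i + 1)))
          \<in> tensor_preorder U A B"
        using i 1(3,7) by (intro tensor_preorder_comp) (auto intro: B_order)
      from tr[OF tr[OF Suc.IH[OF i(2)] this]] turn[OF i(3)] show ?thesis by simp
    qed
  qed simp
  from this[of n] have "((a, b), (ract A (as n) (vs n), b')) \<in> tensor_preorder U A B"
    using 1 by simp
  moreover have "((ract A (as n) (vs n), b'), (a', b')) \<in> tensor_preorder U A B"
    using 1 by (intro tensor_preorder_comp) (auto intro: B_order)
  ultimately show "(p, q) \<in> tensor_preorder U A B" unfolding pq by (rule tr)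
qed

lemma tensor_class_self:
  "a \<in> carrier A \<Longrightarrow> b \<in> carrier B \<Longrightarrow> (a, b) \<in> tensor_class U A B a b"
  by (simp add: tensor_class_def tensor_preorder_refl)

lemma tensor_class_subset: "tensor_class U A B a b \<subseteq> carrier A \<times> carrier B"
  using tensor_preorder_dom by (auto simp: tensor_class_def)

lemma tensor_class_eq_iff:
  assumes "a \<in> carrier A" "b \<in> carrier B" "a' \<in> carrier A" "b' \<in> carrier B"
  shows "tensor_class U A B a b = tensor_class U A B a' b' \<longleftrightarrow>
    ((a, b), (a', b')) \<in> tensor_preorder U A B \<and> ((a', b'), (a, b)) \<in> tensor_preorder U A B"
    (is "?L \<longleftrightarrow> ?R")
proof
  assume ?L
  then have "(a', b') \<in> tensor_class U A B a b"
    using tensor_class_self[OF assms(3,4)] by simp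
  then show ?R by (simp add: tensor_class_def)
next
  assume ?R
  then show ?L using transD[OF tensor_preorder_trans] unfolding tensor_class_def by blast
qed

theorem tensor_leq_iff:
  assumes "a \<in> carrier A" "b \<in> carrier B" "a' \<in> carrier A" "b' \<in> carrier B"
  shows "(tensor_class U A B a b, tensor_class U A B a' b') \<in> tensor_leq U A B \<longleftrightarrow>
    ((a, b), (a', b')) \<in> tensor_preorder U A B" (is "?L \<longleftrightarrow> ?R")
proof
  assume ?L
  then obtain c d c' d' where e: "tensor_class U A B a b = tensor_class U A B c d"
      "tensor_class U A B a' b' = tensor_class U A B c' d'"
      "((c, d), (c', d')) \<in> tensor_preorder U A B"
    unfolding tensor_leq_def by auto
  then have "c \<in> carrier A" "d \<in> carrier B" "c' \<in> carrier A" "d' \<in> carrier B"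
    using tensor_preorder_dom by auto
  with e assms have "((a, b), (c, d)) \<in> tensor_preorder U A B"
    "((c', d'), (a', b')) \<in> tensor_preorder U A B"
    by (auto simp: tensor_class_eq_iff)
  with e(3) show ?R using transD[OF tensor_preorder_trans] by blast
qed (auto simp: tensor_leq_def)

lemma tensor_partial_order: "partial_order_on (tensor_carrier U A B) (tensor_leq U A B)"
  unfolding partial_order_on_def preorder_on_def
proof (intro conjI)
  show "tensor_leq U A B \<subseteq> tensor_carrier U A B \<times> tensor_carrier U A B"
    unfolding tensor_leq_def tensor_carrier_def using tensor_preorder_dom by fastforce
  then have dom: "\<exists>a b a' b'. C = tensor_class U A B a b \<and> D = tensor_class U A B a' b' \<and>
      a \<in> carrier A \<and> b \<in> carrier B \<and> a' \<in> carrier A \<and> b' \<in> carrier B"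
    if "(C, D) \<in> tensor_leq U A B" for C D
    using that unfolding tensor_carrier_def by blast
  show "refl_on (tensor_carrier U A B) (tensor_leq U A B)"
    by (auto simp: refl_on_def tensor_carrier_def tensor_leq_iff tensor_preorder_refl)
  show "trans (tensor_leq U A B)"
  proof (rule transI)
    fix C D E assume CDE: "(C, D) \<in> tensor_leq U A B" "(D, E) \<in> tensor_leq U A B"
    from dom[OF CDE(1)] obtain a b a' b' where
      1: "C = tensor_class U A B a b" "D = tensor_class U A B a' b'"
      "a \<in> carrier A" "b \<in> carrier B" "a' \<in> carrier A" "b' \<in> carrier B" by blast
    from dom[OF CDE(2)] obtain c d where
      2: "E = tensor_class U A B c d" "c \<in> carrier A" "d \<in> carrier B" by blast
    from CDE 1 2 show "(C, E) \<in> tensor_leq U A B"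
      by (auto simp: tensor_leq_iff dest: transD[OF tensor_preorder_trans])
  qed
  show "antisym (tensor_leq U A B)"
  proof (rule antisymI)
    fix C D assume CD: "(C, D) \<in> tensor_leq U A B" "(D, C) \<in> tensor_leq U A B"
    from dom[OF CD(1)] obtain a b a' b' where
      1: "C = tensor_class U A B a b" "D = tensor_class U A B a' b'"
      "a \<in> carrier A" "b \<in> carrier B" "a' \<in> carrier A" "b' \<in> carrier B" by blast
    from CD 1 show "C = D"
      by (simp add: tensor_leq_iff tensor_class_eq_iff)
  qed
qed

lemma UN_tensor_class:
  assumes "a \<in> carrier A" "b \<in> carrier B"
    and "\<And>x y. (x, y) \<in> tensor_class U A B a b \<Longrightarrow> F x y = F a b"
  shows "(\<Union>(x, y)\<in>tensor_class U A B a b. F x y) = F a b"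
  using assms tensor_class_self[OF assms(1,2)] by fast

end

lemma pomonoid_order:
  assumes "pomonoid S"
  shows "leq S \<subseteq> carrier S \<times> carrier S" "a \<in> carrier S \<Longrightarrow> (a, a) \<in> leq S"
    "(a, b) \<in> leq S \<Longrightarrow> (b, c) \<in> leq S \<Longrightarrow> (a, c) \<in> leq S"
    "(a, b) \<in> leq S \<Longrightarrow> (b, a) \<in> leq S \<Longrightarrow> a = b"
  using pomonoid.partial_order[OF assms]
  by (auto simp: partial_order_on_def preorder_on_def refl_on_def dest: transD antisymD)

lemma pomonoid_embedding_hom:
  "pomonoid_embedding S T f \<Longrightarrow> pomonoid S \<Longrightarrow> f \<in> pomonoid_hom S T"
  using pomonoid_order(1)[of S]
  by (fastforce simp: pomonoid_embedding_def pomonoid_hom_def order_embedding_def)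

locale scalar_ext = U: pomonoid U + S: pomonoid S + X: right_poset U X
  for U :: "('u, 'n) pomonoid_scheme" and S :: "('s, 'm) pomonoid_scheme"
    and X :: "('x, 'u) right_act_poset" and f :: "'u \<Rightarrow> 's" +
  assumes hom: "f \<in> pomonoid_hom U S"
begin

lemma f_simps:
  "u \<in> carrier U \<Longrightarrow> f u \<in> carrier S" "f \<one>\<^bsub>U\<^esub> = \<one>\<^bsub>S\<^esub>"
  "u \<in> carrier U \<Longrightarrow> v \<in> carrier U \<Longrightarrow> f (u \<otimes>\<^bsub>U\<^esub> v) = f u \<otimes>\<^bsub>S\<^esub> f v"
  "(u, v) \<in> leq U \<Longrightarrow> (f u, f v) \<in> leq S"
  using hom by (auto simp: pomonoid_hom_def hom_def)

lemma restrict_left_simps [simp]: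
  "carrier (restrict_left f S) = carrier S" "lleq (restrict_left f S) = leq S"
  "lact (restrict_left f S) u s = f u \<otimes>\<^bsub>S\<^esub> s"
  by (simp_all add: restrict_left_def)

lemma left_poset_restrict: "left_poset U (restrict_left f S)"
  using S.one_closed S.partial_order
  by unfold_locales
    (auto simp: f_simps S.m_assoc intro: S.mult_mono_left S.mult_mono_right)

sublocale XS: tensor_pair U X "restrict_left f S"
  by (intro tensor_pair.intro U.pomonoid_axioms X.right_poset_axioms left_poset_restrict)

lemma preorder_mult:
  assumes "((x, s), (x', s')) \<in> tensor_preorder U X (restrict_left f S)" and t: "t \<in> carrier S"
  shows "((x, s \<otimes>\<^bsub>S\<^esub> t), (x', s' \<otimes>\<^bsub>S\<^esub> t)) \<in> tensor_preorder U X (restrict_left f S)"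
proof -
  let ?R = "tensor_preorder U X (restrict_left f S)"
  have "(map_prod id (\<lambda>s. s \<otimes>\<^bsub>S\<^esub> t) p, map_prod id (\<lambda>s. s \<otimes>\<^bsub>S\<^esub> t) q) \<in> ?R"
    if "(p, q) \<in> {((a, b), (a', b')). (a, a') \<in> rleq X \<and> (b, b') \<in> lleq (restrict_left f S)} \<union>
      tensor_gens U X (restrict_left f S) \<union> (tensor_gens U X (restrict_left f S))\<inverse>" for p q
  proof -
    obtain x s x' s' where pq: "p = (x, s)" "q = (x', s')" by (metis surj_pair)
    from that consider "(x, x') \<in> rleq X" "(s, s') \<in> leq S"
      | "((x, s), (x', s')) \<in> tensor_gens U X (restrict_left f S)"
      | "((x', s'), (x, s)) \<in> tensor_gens U X (restrict_left f S)" unfolding pq by auto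
    then show ?thesis
    proof cases
      case 1
      then show ?thesis unfolding pq
        using t by (auto intro: XS.tensor_preorder_comp[simplified] S.mult_mono_left)
    next
      case 2
      then obtain u where "x' \<in> carrier X" "u \<in> carrier U" "s \<in> carrier S"
        "x = ract X x' u" "s' = f u \<otimes>\<^bsub>S\<^esub> s" by (auto simp: tensor_gens_def)
      then show ?thesis unfolding pq
        using XS.tensor_preorder_move(1)[of x' "s \<otimes>\<^bsub>S\<^esub> t" u] t by (simp add: S.m_assoc f_simps)
    next
      case 3
      then obtain u where "x \<in> carrier X" "u \<in> carrier U" "s' \<in> carrier S"
        "x' = ract X x u" "s = f u \<otimes>\<^bsub>S\<^esub> s'" by (auto simp: tensor_gens_def)
      then show ?thesis unfolding pq
        using XS.tensor_preorder_move(2)[of x "s' \<otimes>\<^bsub>S\<^esub> t" u] t by (simp add: S.m_assoc f_simps)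
    qed
  qed
  from trancl_map[where g = "map_prod id (\<lambda>s. s \<otimes>\<^bsub>S\<^esub> t)", OF assms(1)[unfolded tensor_preorder_def] XS.tensor_preorder_trans this]
  show ?thesis by simp
qed

theorem tensor_ext_act:
  assumes "x \<in> carrier X" "s \<in> carrier S" "u \<in> carrier U"
  shows "ract (tensor_ext U X f S) (tensor_class U X (restrict_left f S) x s) u =
    tensor_class U X (restrict_left f S) x (s \<otimes>\<^bsub>S\<^esub> f u)"
proof -
  have "tensor_class U X (restrict_left f S) y (r \<otimes>\<^bsub>S\<^esub> f u) =
      tensor_class U X (restrict_left f S) x (s \<otimes>\<^bsub>S\<^esub> f u)"
    if "(y, r) \<in> tensor_class U X (restrict_left f S) x s" for y r
  proof -
    have "y \<in> carrier X" "r \<in> carrier S"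
      using that XS.tensor_class_subset[of x s] by auto
    with that assms show ?thesis
      by (subst XS.tensor_class_eq_iff) (auto simp: f_simps tensor_class_def intro: preorder_mult)
  qed
  then show ?thesis
    unfolding tensor_ext_def by (simp add: assms XS.UN_tensor_class)
qed

theorem right_poset_tensor_ext: "right_poset U (tensor_ext U X f S)"
proof -
  let ?T = "tensor_class U X (restrict_left f S)"
  have c: "carrier (tensor_ext U X f S) = {?T x s | x s. x \<in> carrier X \<and> s \<in> carrier S}"
    "rleq (tensor_ext U X f S) = tensor_leq U X (restrict_left f S)"
    by (auto simp: tensor_ext_def tensor_carrier_def)
  show ?thesis
  proof
    show "carrier (tensor_ext U X f S) \<noteq> {}"
      using X.nonempty S.one_closed unfolding c by blast
    show "partial_order_on (carrier (tensor_ext U X f S)) (rleq (tensor_ext U X f S))"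
      using XS.tensor_partial_order by (simp add: tensor_ext_def)
    show "(ract (tensor_ext U X f S) C u, ract (tensor_ext U X f S) D u) \<in> rleq (tensor_ext U X f S)"
      if "(C, D) \<in> rleq (tensor_ext U X f S)" "u \<in> carrier U" for C D u
    proof -
      from that(1) obtain x s x' s' where e: "C = ?T x s" "D = ?T x' s'"
        "((x, s), (x', s')) \<in> tensor_preorder U X (restrict_left f S)"
        unfolding c tensor_leq_def by blast
      moreover from this have "x \<in> carrier X" "s \<in> carrier S" "x' \<in> carrier X" "s' \<in> carrier S"
        using XS.tensor_preorder_dom by auto
      ultimately show ?thesis using that(2)
        by (simp add: c tensor_ext_act XS.tensor_leq_iff f_simps preorder_mult)
    qed
    show "(ract (tensor_ext U X f S) C u, ract (tensor_ext U X f S) C v) \<in> rleq (tensor_ext U X f S)"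
      if C: "C \<in> carrier (tensor_ext U X f S)" and uv: "(u, v) \<in> leq U" for C u v
    proof -
      have "u \<in> carrier U" "v \<in> carrier U"
        using uv pomonoid_order(1)[OF U.pomonoid_axioms] by auto
      with C uv show ?thesis
        by (auto simp: c tensor_ext_act XS.tensor_leq_iff f_simps
            intro!: XS.tensor_preorder_comp[simplified] XS.A_order(2) S.mult_mono_right)
    qed
    show "ract (tensor_ext U X f S) C u \<in> carrier (tensor_ext U X f S)"
      if "C \<in> carrier (tensor_ext U X f S)" "u \<in> carrier U" for C u
    proof -
      from that(1) obtain x s where "C = ?T x s" "x \<in> carrier X" "s \<in> carrier S"
        unfolding c by blast
      with that(2) have "ract (tensor_ext U X f S) C u = ?T x (s \<otimes>\<^bsub>S\<^esub> f u)"
        "s \<otimes>\<^bsub>S\<^esub> f u \<in> carrier S" by (simp_all add: tensor_ext_act f_simps)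
      with \<open>x \<in> carrier X\<close> show ?thesis unfolding c by blast
    qed
  qed (auto simp: c tensor_ext_act f_simps S.m_assoc)
qed

theorem poext_map_class:
  assumes Y: "left_poset U Y" and x: "x \<in> carrier X" and y: "y \<in> carrier Y"
  shows "poext_map U X f S Y (tensor_class U X Y x y) =
    tensor_class U (tensor_ext U X f S) Y (tensor_class U X (restrict_left f S) x \<one>\<^bsub>S\<^esub>) y"
proof -
  let ?T = "\<lambda>x. tensor_class U X (restrict_left f S) x \<one>\<^bsub>S\<^esub>"
  interpret XY: tensor_pair U X Y
    by (intro tensor_pair.intro U.pomonoid_axioms X.right_poset_axioms Y)
  interpret XSY: tensor_pair U "tensor_ext U X f S" Y
    by (intro tensor_pair.intro U.pomonoid_axioms right_poset_tensor_ext Y)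
  have T: "?T x \<in> carrier (tensor_ext U X f S)" if "x \<in> carrier X" for x
    using that by (auto simp: tensor_ext_def tensor_carrier_def)
  have act: "?T (ract X x u) = ract (tensor_ext U X f S) (?T x) u"
    if "x \<in> carrier X" "u \<in> carrier U" for x u
    using that XS.tensor_preorder_move[of x "\<one>\<^bsub>S\<^esub>" u]
    by (simp add: tensor_ext_act XS.tensor_class_eq_iff X.act_closed f_simps)
  have mono: "(?T x, ?T x') \<in> rleq (tensor_ext U X f S)" if "(x, x') \<in> rleq X" for x x'
    using that XS.A_order(1)
    by (auto simp: tensor_ext_def tensor_leq_def
        intro!: XS.tensor_preorder_comp XS.B_order(2) exI)
  have pre: "((?T x, y), (?T x', y')) \<in> tensor_preorder U (tensor_ext U X f S) Y"
    if "((x, y), (x', y')) \<in> tensor_preorder U X Y" for x y x' y'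
  proof -
    let ?g = "\<lambda>(x, y). (?T x, y)"
    have "(?g p, ?g q) \<in> tensor_preorder U (tensor_ext U X f S) Y"
      if "(p, q) \<in> {((a, b), (a', b')). (a, a') \<in> rleq X \<and> (b, b') \<in> lleq Y} \<union>
        tensor_gens U X Y \<union> (tensor_gens U X Y)\<inverse>" for p q
    proof -
      obtain x y x' y' where pq: "p = (x, y)" "q = (x', y')" by (metis surj_pair)
      from that consider "(x, x') \<in> rleq X" "(y, y') \<in> lleq Y"
        | "((x, y), (x', y')) \<in> tensor_gens U X Y"
        | "((x', y'), (x, y)) \<in> tensor_gens U X Y" unfolding pq by auto
      then show ?thesis
      proof cases
        case 1
        then show ?thesis unfolding pq by (simp add: mono XSY.tensor_preorder_comp)
      next
        case 2
        then show ?thesis unfolding pq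
          by (auto simp: tensor_gens_def act T XSY.tensor_preorder_move)
      next
        case 3
        then show ?thesis unfolding pq
          by (auto simp: tensor_gens_def act T XSY.tensor_preorder_move)
      qed
    qed
    from trancl_map[where g = ?g, OF that[unfolded tensor_preorder_def] XSY.tensor_preorder_trans this]
    show ?thesis by simp
  qed
  have "tensor_class U (tensor_ext U X f S) Y (?T z) w =
      tensor_class U (tensor_ext U X f S) Y (?T x) y"
    if "(z, w) \<in> tensor_class U X Y x y" for z w
  proof -
    have "z \<in> carrier X" "w \<in> carrier Y"
      using that XY.tensor_class_subset[of x y] by auto
    with that x y T show ?thesis
      by (subst XSY.tensor_class_eq_iff) (auto simp: tensor_class_def[of U X Y] intro: pre)
  qed
  then show ?thesis
    unfolding poext_map_def by (simp add: x y XY.UN_tensor_class)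
qed

end

subsection \<open>Existence of pushouts, independence of the test types\<close>

lemma pomonoid_homD:
  assumes "h \<in> pomonoid_hom S T"
  shows "x \<in> carrier S \<Longrightarrow> h x \<in> carrier T"
    "x \<in> carrier S \<Longrightarrow> y \<in> carrier S \<Longrightarrow> h (x \<otimes>\<^bsub>S\<^esub> y) = h x \<otimes>\<^bsub>T\<^esub> h y"
    "h \<one>\<^bsub>S\<^esub> = \<one>\<^bsub>T\<^esub>" "(x, y) \<in> leq S \<Longrightarrow> (h x, h y) \<in> leq T"
  using assms by (auto simp: pomonoid_hom_def hom_def)

lemma pomonoid_homI:
  assumes "\<And>x. x \<in> carrier S \<Longrightarrow> h x \<in> carrier T"
    "\<And>x y. x \<in> carrier S \<Longrightarrow> y \<in> carrier S \<Longrightarrow> h (x \<otimes>\<^bsub>S\<^esub> y) = h x \<otimes>\<^bsub>T\<^esub> h y"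
    "h \<one>\<^bsub>S\<^esub> = \<one>\<^bsub>T\<^esub>" "\<And>x y. (x, y) \<in> leq S \<Longrightarrow> (h x, h y) \<in> leq T"
  shows "h \<in> pomonoid_hom S T"
  using assms by (auto simp: pomonoid_hom_def hom_def)

lemma pomonoid_hom_comp:
  "h \<in> pomonoid_hom S T \<Longrightarrow> k \<in> pomonoid_hom T R \<Longrightarrow> k \<circ> h \<in> pomonoid_hom S R"
  by (rule pomonoid_homI) (auto simp: pomonoid_homD)

lemma pomonoid_hom_id: "id \<in> pomonoid_hom S S"
  by (rule pomonoid_homI) auto

lemma pushout_wrtE:
  fixes W :: "'w pomonoid"
  assumes "pushout_wrt TYPE('w) U S1 S2 \<phi>1 \<phi>2 P \<iota>1 \<iota>2"
    and "pomonoid W" "f1 \<in> pomonoid_hom S1 W" "f2 \<in> pomonoid_hom S2 W"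
    and "\<And>u. u \<in> carrier U \<Longrightarrow> f1 (\<phi>1 u) = f2 (\<phi>2 u)"
  obtains h where "h \<in> pomonoid_hom P W"
    "\<And>x. x \<in> carrier S1 \<Longrightarrow> h (\<iota>1 x) = f1 x" "\<And>y. y \<in> carrier S2 \<Longrightarrow> h (\<iota>2 y) = f2 y"
    "\<And>h' p. h' \<in> pomonoid_hom P W \<Longrightarrow> (\<And>x. x \<in> carrier S1 \<Longrightarrow> h' (\<iota>1 x) = f1 x) \<Longrightarrow>
       (\<And>y. y \<in> carrier S2 \<Longrightarrow> h' (\<iota>2 y) = f2 y) \<Longrightarrow> p \<in> carrier P \<Longrightarrow> h' p = h p"
proof -
  have "pomonoid W \<and> f1 \<in> pomonoid_hom S1 W \<and> f2 \<in> pomonoid_hom S2 W \<and>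
      (\<forall>u\<in>carrier U. f1 (\<phi>1 u) = f2 (\<phi>2 u))"
    using assms(2-5) by simp
  from assms(1)[unfolded pushout_wrt_def, THEN conjunct2, THEN conjunct2, THEN conjunct2,
    THEN conjunct2, THEN spec[of _ W], THEN spec[of _ f1], THEN spec[of _ f2], THEN mp, OF this]
  show thesis
  proof (elim bexE conjE)
    fix h assume h: "h \<in> pomonoid_hom P W"
      "\<forall>x\<in>carrier S1. h (\<iota>1 x) = f1 x" "\<forall>y\<in>carrier S2. h (\<iota>2 y) = f2 y"
      and unique: "\<forall>h'\<in>pomonoid_hom P W.
        (\<forall>x\<in>carrier S1. h' (\<iota>1 x) = f1 x) \<and> (\<forall>y\<in>carrier S2. h' (\<iota>2 y) = f2 y) \<longrightarrow>
        (\<forall>p\<in>carrier P. h' p = h p)"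
    show thesis
    proof (rule that)
      fix h' p assume h': "h' \<in> pomonoid_hom P W" "\<And>x. x \<in> carrier S1 \<Longrightarrow> h' (\<iota>1 x) = f1 x"
        "\<And>y. y \<in> carrier S2 \<Longrightarrow> h' (\<iota>2 y) = f2 y" and p: "p \<in> carrier P"
      show "h' p = h p"
        by (rule bspec[OF mp[OF bspec[OF unique h'(1)] conjI] p]) (intro ballI h'(2,3); assumption)+
    qed (use h in \<open>auto dest: bspec\<close>)
  qed
qed

context pomonoid_amalgam
begin

lemma phi: "\<phi>1 \<in> pomonoid_hom U S1" "\<phi>2 \<in> pomonoid_hom U S2"
  using embedding1 embedding2 by (auto intro: pomonoid_embedding_hom U.pomonoid_axioms)

definition words :: "('a + 'b) list set" where
  "words = lists (carrier S1 <+> carrier S2)"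

inductive word_rel :: "('a + 'b) list \<Rightarrow> ('a + 'b) list \<Rightarrow> bool" where
  mult1: "x \<in> carrier S1 \<Longrightarrow> y \<in> carrier S1 \<Longrightarrow> word_rel [Inl x, Inl y] [Inl (x \<otimes>\<^bsub>S1\<^esub> y)]"
| mult2: "x \<in> carrier S2 \<Longrightarrow> y \<in> carrier S2 \<Longrightarrow> word_rel [Inr x, Inr y] [Inr (x \<otimes>\<^bsub>S2\<^esub> y)]"
| one1: "word_rel [Inl \<one>\<^bsub>S1\<^esub>] []"
| one2: "word_rel [Inr \<one>\<^bsub>S2\<^esub>] []"
| amalg: "u \<in> carrier U \<Longrightarrow> word_rel [Inl (\<phi>1 u)] [Inr (\<phi>2 u)]"

inductive word_leq :: "('a + 'b) list \<Rightarrow> ('a + 'b) list \<Rightarrow> bool" where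
  refl: "w \<in> words \<Longrightarrow> word_leq w w"
| trans: "word_leq u v \<Longrightarrow> word_leq v w \<Longrightarrow> word_leq u w"
| append: "word_leq v w \<Longrightarrow> word_leq v' w' \<Longrightarrow> word_leq (v @ v') (w @ w')"
| mono1: "(x, y) \<in> leq S1 \<Longrightarrow> word_leq [Inl x] [Inl y]"
| mono2: "(x, y) \<in> leq S2 \<Longrightarrow> word_leq [Inr x] [Inr y]"
| rel: "word_rel v w \<Longrightarrow> word_leq v w"
| rel': "word_rel v w \<Longrightarrow> word_leq w v"

lemma words_simps [simp]:
  "[] \<in> words" "Inl x # w \<in> words \<longleftrightarrow> x \<in> carrier S1 \<and> w \<in> words"
  "Inr y # w \<in> words \<longleftrightarrow> y \<in> carrier S2 \<and> w \<in> words"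
  "v @ w \<in> words \<longleftrightarrow> v \<in> words \<and> w \<in> words"
  by (auto simp: words_def)

lemma word_rel_words: "word_rel v w \<Longrightarrow> v \<in> words \<and> w \<in> words"
  by (induction rule: word_rel.induct) (auto intro: pomonoid_homD(1) phi)

lemma word_leq_words: "word_leq v w \<Longrightarrow> v \<in> words \<and> w \<in> words"
  by (induction rule: word_leq.induct)
    (use pomonoid_order(1)[OF S1.pomonoid_axioms] pomonoid_order(1)[OF S2.pomonoid_axioms]
       word_rel_words in auto)

definition word_class :: "('a + 'b) list \<Rightarrow> ('a + 'b) list set" where
  "word_class w = {v. word_leq w v \<and> word_leq v w}"

definition free_product :: "('a + 'b) list set pomonoid" where
  "free_product = \<lparr>carrier = word_class ` words,
     monoid.mult = (\<lambda>C D. \<Union>v\<in>C. \<Union>w\<in>D. word_class (v @ w)),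
     one = word_class [],
     leq = {(word_class v, word_class w) | v w. word_leq v w}\<rparr>"

lemma word_class_eq_iff:
  assumes "v \<in> words" "w \<in> words"
  shows "word_class v = word_class w \<longleftrightarrow> word_leq v w \<and> word_leq w v"
  using assms unfolding word_class_def by (blast intro: word_leq.refl word_leq.trans)

lemma free_product_simps:
  "carrier free_product = word_class ` words"
  "\<one>\<^bsub>free_product\<^esub> = word_class []"
  by (simp_all add: free_product_def)

lemma free_product_mult:
  assumes "v \<in> words" "w \<in> words"
  shows "word_class v \<otimes>\<^bsub>free_product\<^esub> word_class w = word_class (v @ w)"
proof -
  have e: "word_class (v' @ w') = word_class (v @ w)"
    if "v' \<in> word_class v" "w' \<in> word_class w" for v' w'
  proof -
    have "word_leq v v'" "word_leq v' v" "word_leq w w'" "word_leq w' w"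
      using that by (auto simp: word_class_def)
    then show ?thesis
      using word_leq_words[of v v'] word_leq_words[of w w']
      by (simp add: word_class_eq_iff word_leq.append)
  qed
  have "v \<in> word_class v" "w \<in> word_class w"
    using assms by (auto simp: word_class_def intro: word_leq.refl)
  then have "(\<Union>v'\<in>word_class v. \<Union>w'\<in>word_class w. word_class (v' @ w')) = word_class (v @ w)"
    using e by blast
  then show ?thesis by (simp add: free_product_def)
qed

lemma free_product_leq:
  assumes "v \<in> words" "w \<in> words"
  shows "(word_class v, word_class w) \<in> leq free_product \<longleftrightarrow> word_leq v w"
proof
  assume "(word_class v, word_class w) \<in> leq free_product"
  then obtain v' w' where e: "word_class v = word_class v'" "word_class w = word_class w'" "word_leq v' w'"
    by (auto simp: free_product_def)
  with assms show "word_leq v w"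
    using word_leq_words[of v' w'] by (metis word_class_eq_iff word_leq.trans)
qed (auto simp: free_product_def)

lemma free_product_leqE:
  assumes "(C, D) \<in> leq free_product"
  obtains v w where "C = word_class v" "D = word_class w" "v \<in> words" "w \<in> words" "word_leq v w"
  using assms word_leq_words by (auto simp: free_product_def)

lemma pomonoid_free_product: "pomonoid free_product"
proof (intro pomonoid.intro monoid.intro pomonoid_axioms.intro)
  show "C \<otimes>\<^bsub>free_product\<^esub> D \<in> carrier free_product"
    if "C \<in> carrier free_product" "D \<in> carrier free_product" for C D
    using that unfolding free_product_simps by (elim imageE) (simp add: free_product_mult)
  show "\<one>\<^bsub>free_product\<^esub> \<in> carrier free_product" by (simp add: free_product_simps)
  show "C \<otimes>\<^bsub>free_product\<^esub> D \<otimes>\<^bsub>free_product\<^esub> E = C \<otimes>\<^bsub>free_product\<^esub> (D \<otimes>\<^bsub>free_product\<^esub> E)"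
    if "C \<in> carrier free_product" "D \<in> carrier free_product" "E \<in> carrier free_product" for C D E
    using that unfolding free_product_simps by (elim imageE) (simp add: free_product_mult)
  show "\<one>\<^bsub>free_product\<^esub> \<otimes>\<^bsub>free_product\<^esub> C = C" "C \<otimes>\<^bsub>free_product\<^esub> \<one>\<^bsub>free_product\<^esub> = C"
    if "C \<in> carrier free_product" for C
    using that unfolding free_product_simps by (elim imageE; simp add: free_product_mult)+
  show "partial_order_on (carrier free_product) (leq free_product)"
    unfolding partial_order_on_def preorder_on_def
  proof (intro conjI)
    show "leq free_product \<subseteq> carrier free_product \<times> carrier free_product"
      by (auto simp: free_product_simps elim!: free_product_leqE)
    show "refl_on (carrier free_product) (leq free_product)"
      by (auto simp: refl_on_def free_product_simps free_product_leq word_leq.refl)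
    show "Relation.trans (leq free_product)"
    proof (rule transI)
      fix C D E assume CDE: "(C, D) \<in> leq free_product" "(D, E) \<in> leq free_product"
      from CDE(1) obtain v w where 1: "C = word_class v" "D = word_class w" "v \<in> words" "w \<in> words"
        by (rule free_product_leqE)
      from CDE(2) obtain w' where 2: "E = word_class w'" "w' \<in> words"
        by (rule free_product_leqE)
      from CDE show "(C, E) \<in> leq free_product"
        unfolding 1(1,2) 2(1) using 1(3,4) 2(2) word_leq.trans[of v w w'] by (simp add: free_product_leq)
    qed
    show "antisym (leq free_product)"
    proof (rule antisymI)
      fix C D assume CD: "(C, D) \<in> leq free_product" "(D, C) \<in> leq free_product"
      from CD(1) obtain v w where 1: "C = word_class v" "D = word_class w" "v \<in> words" "w \<in> words"
        by (rule free_product_leqE)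
      from CD show "C = D" unfolding 1(1,2) using 1 by (simp add: free_product_leq word_class_eq_iff)
    qed
  qed
next
  fix C D E assume C: "C \<in> carrier free_product" and DE: "(D, E) \<in> leq free_product"
  from C obtain u where u: "C = word_class u" "u \<in> words" by (auto simp: free_product_simps)
  from DE obtain v w where vw: "D = word_class v" "E = word_class w" "v \<in> words" "w \<in> words"
    "word_leq v w" by (rule free_product_leqE)
  show "(C \<otimes>\<^bsub>free_product\<^esub> D, C \<otimes>\<^bsub>free_product\<^esub> E) \<in> leq free_product"
    "(D \<otimes>\<^bsub>free_product\<^esub> C, E \<otimes>\<^bsub>free_product\<^esub> C) \<in> leq free_product"
    unfolding u(1) vw(1,2) using u(2) vw(3-)
    by (simp_all add: free_product_mult free_product_leq word_leq.append word_leq.refl)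
qed

definition inj1 :: "'a \<Rightarrow> ('a + 'b) list set" where "inj1 x = word_class [Inl x]"
definition inj2 :: "'b \<Rightarrow> ('a + 'b) list set" where "inj2 y = word_class [Inr y]"

lemma inj1_hom: "inj1 \<in> pomonoid_hom S1 free_product"
proof (rule pomonoid_homI)
  show "(inj1 x, inj1 y) \<in> leq free_product" if "(x, y) \<in> leq S1" for x y
    using that by (auto simp: inj1_def free_product_def intro: word_leq.mono1)
qed (auto simp: inj1_def free_product_simps free_product_mult word_class_eq_iff
      intro: word_leq.rel word_leq.rel' word_rel.intros)

lemma inj2_hom: "inj2 \<in> pomonoid_hom S2 free_product"
proof (rule pomonoid_homI)
  show "(inj2 x, inj2 y) \<in> leq free_product" if "(x, y) \<in> leq S2" for x y
    using that by (auto simp: inj2_def free_product_def intro: word_leq.mono2)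
qed (auto simp: inj2_def free_product_simps free_product_mult word_class_eq_iff
      intro: word_leq.rel word_leq.rel' word_rel.intros)

lemma inj_amalg: "u \<in> carrier U \<Longrightarrow> inj1 (\<phi>1 u) = inj2 (\<phi>2 u)"
  unfolding inj1_def inj2_def
  by (subst word_class_eq_iff)
    (auto intro: pomonoid_homD(1) phi word_leq.rel word_leq.rel' word_rel.intros)

lemma words_induct [consumes 1, case_names Nil Inl Inr]:
  assumes "w \<in> words" and "P []"
    and "\<And>x w. x \<in> carrier S1 \<Longrightarrow> w \<in> words \<Longrightarrow> P w \<Longrightarrow> P (Inl x # w)"
    and "\<And>y w. y \<in> carrier S2 \<Longrightarrow> w \<in> words \<Longrightarrow> P w \<Longrightarrow> P (Inr y # w)"
  shows "P w"
  using assms(1)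
proof (induction w)
  case (Cons l w) then show ?case using assms(3,4) by (cases l) auto
qed (rule assms(2))

theorem free_product_pushout:
  "pushout_wrt TYPE('w) U S1 S2 \<phi>1 \<phi>2 free_product inj1 inj2"
  unfolding pushout_wrt_def
proof (intro conjI allI impI ballI pomonoid_free_product inj1_hom inj2_hom inj_amalg)
  fix W :: "'w pomonoid" and f1 f2
  assume "pomonoid W \<and> f1 \<in> pomonoid_hom S1 W \<and> f2 \<in> pomonoid_hom S2 W \<and>
    (\<forall>u\<in>carrier U. f1 (\<phi>1 u) = f2 (\<phi>2 u))"
  then have W: "pomonoid W" and f1: "f1 \<in> pomonoid_hom S1 W" and f2: "f2 \<in> pomonoid_hom S2 W"
    and f: "\<And>u. u \<in> carrier U \<Longrightarrow> f1 (\<phi>1 u) = f2 (\<phi>2 u)" by auto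
  interpret W: pomonoid W by (rule W)
  define ev where "ev w = foldr (\<lambda>l acc. (case l of Inl x \<Rightarrow> f1 x | Inr y \<Rightarrow> f2 y) \<otimes>\<^bsub>W\<^esub> acc) w \<one>\<^bsub>W\<^esub>" for w
  have ev_Cons: "ev [] = \<one>\<^bsub>W\<^esub>" "ev (Inl x # w) = f1 x \<otimes>\<^bsub>W\<^esub> ev w" "ev (Inr y # w) = f2 y \<otimes>\<^bsub>W\<^esub> ev w"
    for x y w by (simp_all add: ev_def)
  have ev_closed: "ev w \<in> carrier W" if "w \<in> words" for w
    using that by (induction rule: words_induct) (auto simp: ev_Cons pomonoid_homD[OF f1] pomonoid_homD[OF f2])
  have ev_append: "ev (v @ w) = ev v \<otimes>\<^bsub>W\<^esub> ev w" if "v \<in> words" "w \<in> words" for v w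
    using that(1) by (induction rule: words_induct)
      (auto simp: ev_Cons ev_closed that(2) W.m_assoc pomonoid_homD[OF f1] pomonoid_homD[OF f2])
  note W_ord = pomonoid_order[OF W]
  have ev_rel: "ev v = ev w" if "word_rel v w" for v w
    using that by (induction rule: word_rel.induct)
      (auto simp: ev_Cons f pomonoid_homD[OF f1] pomonoid_homD[OF f2] pomonoid_homD(1)[OF phi(1)]
        pomonoid_homD(1)[OF phi(2)])
  have ev_mono: "(ev v, ev w) \<in> leq W" if "word_leq v w" for v w
    using that
  proof (induction rule: word_leq.induct)
    case (append v w v' w')
    then have "v \<in> words" "w \<in> words" "v' \<in> words" "w' \<in> words" using word_leq_words by auto
    then show ?case
      using append W.mult_mono_left[OF ev_closed, of v' "ev v" "ev w"]
        W.mult_mono_right[OF ev_closed, of w "ev v'" "ev w'"] W_ord(3)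
      by (simp add: ev_append)
  next
    case (mono1 x y)
    then have "(f1 x, f1 y) \<in> leq W" by (rule pomonoid_homD(4)[OF f1])
    then show ?case using W_ord(1) by (auto simp: ev_Cons)
  next
    case (mono2 x y)
    then have "(f2 x, f2 y) \<in> leq W" by (rule pomonoid_homD(4)[OF f2])
    then show ?case using W_ord(1) by (auto simp: ev_Cons)
  next
    case (rel v w) then show ?case using ev_rel word_rel_words W_ord(2) ev_closed by metis
  next
    case (rel' v w) then show ?case using ev_rel word_rel_words W_ord(2) ev_closed by metis
  qed (use W_ord(2,3) ev_closed in blast)+
  define h where "h C = ev (SOME w. w \<in> words \<and> word_class w = C)" for C
  have h: "h (word_class w) = ev w" if "w \<in> words" for w
  proof -
    let ?v = "SOME v. v \<in> words \<and> word_class v = word_class w"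
    have "?v \<in> words \<and> word_class ?v = word_class w"
      using that by (intro someI[of "\<lambda>v. v \<in> words \<and> word_class v = word_class w"]) simp
    then have "word_leq ?v w" "word_leq w ?v" using that by (auto simp: word_class_eq_iff)
    then show ?thesis unfolding h_def using ev_mono W_ord(4) by blast
  qed
  have hom: "h \<in> pomonoid_hom free_product W"
    by (rule pomonoid_homI)
      (auto simp: free_product_simps free_product_mult h ev_closed ev_append ev_Cons ev_mono
        elim: free_product_leqE)
  have h1: "h (inj1 x) = f1 x" if "x \<in> carrier S1" for x
    using that by (simp add: inj1_def h ev_Cons pomonoid_homD[OF f1])
  have h2: "h (inj2 x) = f2 x" if "x \<in> carrier S2" for x
    using that by (simp add: inj2_def h ev_Cons pomonoid_homD[OF f2])
  have "h' p = h p"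
    if h': "h' \<in> pomonoid_hom free_product W" and e: "\<forall>x\<in>carrier S1. h' (inj1 x) = f1 x"
      "\<forall>y\<in>carrier S2. h' (inj2 y) = f2 y" and p: "p \<in> carrier free_product" for h' p
  proof -
    have "h' (word_class w) = ev w" if "w \<in> words" for w
      using that
    proof (induction rule: words_induct)
      case Nil then show ?case using pomonoid_homD(3)[OF h'] by (simp add: ev_Cons free_product_simps)
    next
      case (Inl x w)
      then have "word_class (Inl x # w) = inj1 x \<otimes>\<^bsub>free_product\<^esub> word_class w"
        by (simp add: inj1_def free_product_mult)
      then show ?case
        using Inl e pomonoid_homD(2)[OF h'] by (simp add: ev_Cons free_product_simps inj1_def)
    next
      case (Inr x w)
      then have "word_class (Inr x # w) = inj2 x \<otimes>\<^bsub>free_product\<^esub> word_class w"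
        by (simp add: inj2_def free_product_mult)
      then show ?case
        using Inr e pomonoid_homD(2)[OF h'] by (simp add: ev_Cons free_product_simps inj2_def)
    qed
    then show ?thesis using p h by (auto simp: free_product_simps)
  qed
  with hom h1 h2 show "\<exists>h\<in>pomonoid_hom free_product W.
      (\<forall>x\<in>carrier S1. h (inj1 x) = f1 x) \<and> (\<forall>y\<in>carrier S2. h (inj2 y) = f2 y) \<and>
      (\<forall>h'\<in>pomonoid_hom free_product W.
        (\<forall>x\<in>carrier S1. h' (inj1 x) = f1 x) \<and> (\<forall>y\<in>carrier S2. h' (inj2 y) = f2 y) \<longrightarrow>
        (\<forall>p\<in>carrier free_product. h' p = h p))"
    by blast
qed

theorem amalgamated_free_product_exists:
  "amalgamated_free_product U S1 S2 \<phi>1 \<phi>2 free_product inj1 inj2"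
  by (simp add: amalgamated_free_product_def free_product_pushout)

theorem amalgamated_free_product_pushout:
  fixes P :: "'p pomonoid"
  assumes "amalgamated_free_product U S1 S2 \<phi>1 \<phi>2 P \<iota>1 \<iota>2"
  shows "pushout_wrt TYPE('w) U S1 S2 \<phi>1 \<phi>2 P \<iota>1 \<iota>2"
proof -
  have Pp: "pushout_wrt TYPE('p) U S1 S2 \<phi>1 \<phi>2 P \<iota>1 \<iota>2"
    and Pw: "pushout_wrt TYPE(('a + 'b) list set) U S1 S2 \<phi>1 \<phi>2 P \<iota>1 \<iota>2"
    using assms by (auto simp: amalgamated_free_product_def)
  from Pp have P: "pomonoid P" "\<iota>1 \<in> pomonoid_hom S1 P" "\<iota>2 \<in> pomonoid_hom S2 P"
    "\<forall>u\<in>carrier U. \<iota>1 (\<phi>1 u) = \<iota>2 (\<phi>2 u)" by (auto simp: pushout_wrt_def)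
  obtain h where h: "h \<in> pomonoid_hom P free_product"
    "\<And>x. x \<in> carrier S1 \<Longrightarrow> h (\<iota>1 x) = inj1 x" "\<And>y. y \<in> carrier S2 \<Longrightarrow> h (\<iota>2 y) = inj2 y"
    using pushout_wrtE[OF Pw pomonoid_free_product inj1_hom inj2_hom inj_amalg] by metis
  obtain k where k: "k \<in> pomonoid_hom free_product P"
    "\<And>x. x \<in> carrier S1 \<Longrightarrow> k (inj1 x) = \<iota>1 x" "\<And>y. y \<in> carrier S2 \<Longrightarrow> k (inj2 y) = \<iota>2 y"
    using pushout_wrtE[OF free_product_pushout P(1-3)] P(4) by metis
  have kh: "k (h p) = p" if p: "p \<in> carrier P" for p
  proof -
    obtain g where g: "\<And>h' p. h' \<in> pomonoid_hom P P \<Longrightarrow> (\<And>x. x \<in> carrier S1 \<Longrightarrow> h' (\<iota>1 x) = \<iota>1 x) \<Longrightarrow>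
       (\<And>y. y \<in> carrier S2 \<Longrightarrow> h' (\<iota>2 y) = \<iota>2 y) \<Longrightarrow> p \<in> carrier P \<Longrightarrow> h' p = g p"
      by (rule pushout_wrtE[OF Pp P(1-3)]) (use P(4) in blast)+
    have "(k \<circ> h) p = g p"
      using pomonoid_hom_comp[OF h(1) k(1)] by (rule g) (simp_all add: h k p)
    moreover have "id p = g p"
      using pomonoid_hom_id by (rule g) (simp_all add: p)
    ultimately show ?thesis by simp
  qed
  show ?thesis
    unfolding pushout_wrt_def
  proof (intro conjI allI impI P)
    fix W :: "'w pomonoid" and f1 f2
    assume "pomonoid W \<and> f1 \<in> pomonoid_hom S1 W \<and> f2 \<in> pomonoid_hom S2 W \<and>
      (\<forall>u\<in>carrier U. f1 (\<phi>1 u) = f2 (\<phi>2 u))"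
    then have W: "pomonoid W" "f1 \<in> pomonoid_hom S1 W" "f2 \<in> pomonoid_hom S2 W"
      "\<And>u. u \<in> carrier U \<Longrightarrow> f1 (\<phi>1 u) = f2 (\<phi>2 u)" by auto
    obtain l where l: "l \<in> pomonoid_hom free_product W"
      "\<And>x. x \<in> carrier S1 \<Longrightarrow> l (inj1 x) = f1 x" "\<And>y. y \<in> carrier S2 \<Longrightarrow> l (inj2 y) = f2 y"
      and u: "\<And>h' p. h' \<in> pomonoid_hom free_product W \<Longrightarrow>
        (\<And>x. x \<in> carrier S1 \<Longrightarrow> h' (inj1 x) = f1 x) \<Longrightarrow>
        (\<And>y. y \<in> carrier S2 \<Longrightarrow> h' (inj2 y) = f2 y) \<Longrightarrow> p \<in> carrier free_product \<Longrightarrow> h' p = l p"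
    proof (rule pushout_wrtE[OF free_product_pushout W])
      fix l assume l: "l \<in> pomonoid_hom free_product W"
        "\<And>x. x \<in> carrier S1 \<Longrightarrow> l (inj1 x) = f1 x" "\<And>y. y \<in> carrier S2 \<Longrightarrow> l (inj2 y) = f2 y"
        "\<And>h' p. h' \<in> pomonoid_hom free_product W \<Longrightarrow>
          (\<And>x. x \<in> carrier S1 \<Longrightarrow> h' (inj1 x) = f1 x) \<Longrightarrow>
          (\<And>y. y \<in> carrier S2 \<Longrightarrow> h' (inj2 y) = f2 y) \<Longrightarrow> p \<in> carrier free_product \<Longrightarrow> h' p = l p"
      show thesis by (rule that) (fact l)+
    qed
    have "h' p = l (h p)" if h': "h' \<in> pomonoid_hom P W" "\<forall>x\<in>carrier S1. h' (\<iota>1 x) = f1 x"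
      "\<forall>y\<in>carrier S2. h' (\<iota>2 y) = f2 y" and p: "p \<in> carrier P" for h' p
    proof -
      have "(h' \<circ> k) (h p) = l (h p)"
        using pomonoid_hom_comp[OF k(1) h'(1)]
        by (rule u) (simp_all add: k h' p pomonoid_homD(1)[OF h(1)])
      then show ?thesis by (simp add: kh p)
    qed
    then show "\<exists>h\<in>pomonoid_hom P W.
        (\<forall>x\<in>carrier S1. h (\<iota>1 x) = f1 x) \<and> (\<forall>y\<in>carrier S2. h (\<iota>2 y) = f2 y) \<and>
        (\<forall>h'\<in>pomonoid_hom P W.
          (\<forall>x\<in>carrier S1. h' (\<iota>1 x) = f1 x) \<and> (\<forall>y\<in>carrier S2. h' (\<iota>2 y) = f2 y) \<longrightarrow>
          (\<forall>p\<in>carrier P. h' p = h p))"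
      using h l by (intro bexI[OF _ pomonoid_hom_comp[OF h(1) l(1)]]) auto
  qed
qed

theorem strongly_poembeddable_inD:
  assumes "strongly_poembeddable_in TYPE('w) U S1 S2 \<phi>1 \<phi>2"
  shows "strongly_poembeddable U S1 S2 \<phi>1 \<phi>2"
proof -
  from assms obtain W :: "'w pomonoid" and \<theta>1 \<theta>2 where W: "pomonoid W"
    and t1: "pomonoid_embedding S1 W \<theta>1" and t2: "pomonoid_embedding S2 W \<theta>2"
    and t: "\<forall>u\<in>carrier U. \<theta>1 (\<phi>1 u) = \<theta>2 (\<phi>2 u)"
    and int: "\<theta>1 ` carrier S1 \<inter> \<theta>2 ` carrier S2 = \<theta>1 ` \<phi>1 ` carrier U"
    unfolding strongly_poembeddable_in_def by blast
  obtain h where h: "h \<in> pomonoid_hom free_product W"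
    "\<And>x. x \<in> carrier S1 \<Longrightarrow> h (inj1 x) = \<theta>1 x" "\<And>y. y \<in> carrier S2 \<Longrightarrow> h (inj2 y) = \<theta>2 y"
    by (rule pushout_wrtE[OF free_product_pushout W pomonoid_embedding_hom[OF t1 S1.pomonoid_axioms]
      pomonoid_embedding_hom[OF t2 S2.pomonoid_axioms]]) (use t in blast)+
  have r1: "(\<theta>1 x, \<theta>1 y) \<in> leq W"
    if "(inj1 x, inj1 y) \<in> leq free_product" "x \<in> carrier S1" "y \<in> carrier S1" for x y
    using pomonoid_homD(4)[OF h(1) that(1)] that(2,3) by (simp add: h)
  have e1: "pomonoid_embedding S1 free_product inj1"
    using t1 inj1_hom r1
    unfolding pomonoid_embedding_def order_embedding_def
    by (auto simp: pomonoid_hom_def hom_def)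
  have r2: "(\<theta>2 x, \<theta>2 y) \<in> leq W"
    if "(inj2 x, inj2 y) \<in> leq free_product" "x \<in> carrier S2" "y \<in> carrier S2" for x y
    using pomonoid_homD(4)[OF h(1) that(1)] that(2,3) by (simp add: h)
  have e2: "pomonoid_embedding S2 free_product inj2"
    using t2 inj2_hom r2
    unfolding pomonoid_embedding_def order_embedding_def
    by (auto simp: pomonoid_hom_def hom_def)
  have inj: "inj_on \<theta>1 (carrier S1)"
    using t1 pomonoid_order(2)[OF W] pomonoid_order(4)[OF S1.pomonoid_axioms]
    unfolding pomonoid_embedding_def order_embedding_def by (intro inj_onI) (metis Pi_mem)
  have "inj1 ` carrier S1 \<inter> inj2 ` carrier S2 = inj1 ` \<phi>1 ` carrier U"
  proof (intro equalityI subsetI)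
    fix c assume "c \<in> inj1 ` carrier S1 \<inter> inj2 ` carrier S2"
    then obtain x y where xy: "c = inj1 x" "c = inj2 y" "x \<in> carrier S1" "y \<in> carrier S2" by blast
    then have "\<theta>1 x = \<theta>2 y" using h by metis
    then have "\<theta>1 x \<in> \<theta>1 ` \<phi>1 ` carrier U" using xy int by blast
    then show "c \<in> inj1 ` \<phi>1 ` carrier U"
      using xy inj pomonoid_homD(1)[OF phi(1)] unfolding inj_on_def by blast
  next
    fix c assume "c \<in> inj1 ` \<phi>1 ` carrier U"
    then show "c \<in> inj1 ` carrier S1 \<inter> inj2 ` carrier S2"
      using inj_amalg pomonoid_homD(1)[OF phi(1)] pomonoid_homD(1)[OF phi(2)] by force
  qed
  with e1 e2 inj_amalg pomonoid_free_product show ?thesis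
    unfolding strongly_poembeddable_def strongly_poembeddable_in_def by blast
qed

end

end

theory Submission
  imports Defs
begin

text \<open>
  Strong pounitarity says that \<open>A\<^sub>i = S\<^sub>i - U\<close> is stable under multiplication by \<open>U\<close> on both sides
  and that no element of \<open>A\<^sub>i\<close> is comparable with an element of \<open>U\<close>: as a poset with two actions
  of \<open>U\<close>, \<open>S\<^sub>i\<close> is the disjoint union of \<open>U\<close> and \<open>A\<^sub>i\<close>. Products of two elements of \<open>A\<^sub>i\<close>
  may still fall into \<open>U\<close>, as they do for groups, and the proof is an ordered version of van der
  Waerden's argument for amalgamated products of groups.

  Given a left \<open>U\<close>-poset \<open>Y\<close>, let \<open>N\<close> be the disjoint union of all iterated tensor products
  \<open>A\<^sub>i \<otimes> A\<^sub>j \<otimes> ... \<otimes> Y\<close> with alternating indices, \<open>Y\<close> itself being the one with no factor.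
  If \<open>N\<^sub>i\<close> collects the products beginning with \<open>A\<^sub>i\<close>, then
  \<open>N = (N - N\<^sub>i) \<union> A\<^sub>i \<otimes> (N - N\<^sub>i)\<close>, which is \<open>S\<^sub>i \<otimes> (N - N\<^sub>i)\<close> by the decomposition
  of \<open>S\<^sub>i\<close>. Hence \<open>S\<^sub>1\<close> and \<open>S\<^sub>2\<close> both act on \<open>N\<close> by monotone maps, their actions agree on
  \<open>U\<close>, and so the amalgamated free product acts on \<open>N\<close> (\<open>wact_mono_left\<close>). The elements of
  \<open>N\<close> are represented by reduced towers, ordered by the preorder \<open>tle\<close>. Two consequences
  prove the theorem.

  Poextension: \<open>Y\<close> is a summand of the \<open>U\<close>-poset \<open>N\<close>, so \<open>X \<otimes> Y\<close> is a summand of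
  \<open>X \<otimes> N\<close>. Since \<open>x \<otimes> p \<otimes> y \<mapsto> x \<otimes> p y\<close> maps \<open>X \<otimes> P \<otimes> Y\<close> monotonically to \<open>X \<otimes> N\<close> and
  sends \<open>x \<otimes> 1 \<otimes> y\<close> to \<open>x \<otimes> y\<close>, inequalities between elements \<open>x \<otimes> 1 \<otimes> y\<close> already hold in
  \<open>X \<otimes> Y\<close> (\<open>order_embedding_poext_map\<close>).

  Embedding: for \<open>Y = U\<close>, letting a letter \<open>s\<close> of \<open>S\<^sub>i\<close> act on the unit of \<open>U\<close> returns \<open>s\<close> as an
  element of \<open>U\<close> or of \<open>A\<^sub>i \<otimes> U\<close>, a copy of \<open>A\<^sub>i\<close>. So an inequality of two letters in the free
  product holds in their factor if they lie in the same one, and forces them into \<open>U\<close> otherwise.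
\<close>

section \<open>A criterion for the poextension property\<close>

lemma (in scalar_ext) tensor_unit_mono:
  assumes Y: "left_poset U Y"
    and le: "((x, y), (x', y')) \<in> tensor_preorder U X Y"
  shows "((tensor_class U X (restrict_left f S) x \<one>\<^bsub>S\<^esub>, y),
      (tensor_class U X (restrict_left f S) x' \<one>\<^bsub>S\<^esub>, y')) \<in> tensor_preorder U (tensor_ext U X f S) Y"
proof -
  let ?T = "\<lambda>x. tensor_class U X (restrict_left f S) x \<one>\<^bsub>S\<^esub>"
  interpret XSY: tensor_pair U "tensor_ext U X f S" Y
    by (intro tensor_pair.intro U.pomonoid_axioms right_poset_tensor_ext Y)
  have T: "?T x \<in> carrier (tensor_ext U X f S)" if "x \<in> carrier X" for x
    using that by (auto simp: tensor_ext_def tensor_carrier_def)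
  have act: "?T (ract X x u) = ract (tensor_ext U X f S) (?T x) u"
    if "x \<in> carrier X" "u \<in> carrier U" for x u
    using that XS.tensor_preorder_move[of x "\<one>\<^bsub>S\<^esub>" u]
    by (simp add: tensor_ext_act XS.tensor_class_eq_iff X.act_closed f_simps)
  have mono: "(?T x, ?T x') \<in> rleq (tensor_ext U X f S)" if "(x, x') \<in> rleq X" for x x'
    using that XS.A_order(1)
    by (auto simp: tensor_ext_def tensor_leq_def intro!: XS.tensor_preorder_comp XS.B_order(2) exI)
  have "(map_prod ?T id p, map_prod ?T id q) \<in> tensor_preorder U (tensor_ext U X f S) Y"
    if "(p, q) \<in> {((a, b), (a', b')). (a, a') \<in> rleq X \<and> (b, b') \<in> lleq Y} \<union>
      tensor_gens U X Y \<union> (tensor_gens U X Y)\<inverse>" for p q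
    using that
    by (auto simp: tensor_gens_def mono act T XSY.tensor_preorder_comp XSY.tensor_preorder_move)
  from trancl_map[where g = "map_prod ?T id", OF le[unfolded tensor_preorder_def]
      XSY.tensor_preorder_trans this]
  show ?thesis by simp
qed

text \<open>
  The map is an order embedding as soon as \<open>Y\<close> is a \<open>U\<close>-summand of some preordered set \<open>N\<close> on
  which \<open>S\<close> acts. Here \<open>le\<close> is the preorder of \<open>N\<close>, the action laws hold up to the equivalence
  of \<open>le\<close>, \<open>D\<close> is the summand, and \<open>j\<close> and \<open>r\<close> identify it with \<open>Y\<close>. The tensor product
  \<open>X \<otimes> N\<close> need not be formed: its order enters only through the question whether two elements
  both lie in \<open>X \<otimes> D\<close> and are comparable there, which is the relation \<open>G\<close> of the proof.
\<close>
lemma (in scalar_ext) order_embedding_poext_map: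
  fixes le :: "'z \<Rightarrow> 'z \<Rightarrow> bool" and act :: "'s \<Rightarrow> 'z \<Rightarrow> 'z"
  assumes Y: "left_poset U Y"
    and trans: "\<And>k m n. le k m \<Longrightarrow> le m n \<Longrightarrow> le k n"
    and closed: "\<And>s n. s \<in> carrier S \<Longrightarrow> n \<in> N \<Longrightarrow> act s n \<in> N"
    and mono: "\<And>s m n. s \<in> carrier S \<Longrightarrow> le m n \<Longrightarrow> le (act s m) (act s n)"
    and mono_left: "\<And>s t n. (s, t) \<in> leq S \<Longrightarrow> n \<in> N \<Longrightarrow> le (act s n) (act t n)"
    and act_mult: "\<And>s t n. s \<in> carrier S \<Longrightarrow> t \<in> carrier S \<Longrightarrow> n \<in> N \<Longrightarrow>
      le (act (s \<otimes>\<^bsub>S\<^esub> t) n) (act s (act t n)) \<and> le (act s (act t n)) (act (s \<otimes>\<^bsub>S\<^esub> t) n)"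
    and act_one: "\<And>n. n \<in> N \<Longrightarrow> le (act \<one>\<^bsub>S\<^esub> n) n \<and> le n (act \<one>\<^bsub>S\<^esub> n)"
    and j_closed: "\<And>y. y \<in> carrier Y \<Longrightarrow> j y \<in> N \<inter> D"
    and j_mono: "\<And>y y'. (y, y') \<in> lleq Y \<Longrightarrow> le (j y) (j y')"
    and j_act: "\<And>u y. u \<in> carrier U \<Longrightarrow> y \<in> carrier Y \<Longrightarrow>
      le (j (lact Y u y)) (act (f u) (j y)) \<and> le (act (f u) (j y)) (j (lact Y u y))"
    and D_le: "\<And>m n. le m n \<Longrightarrow> m \<in> D \<longleftrightarrow> n \<in> D"
    and D_act: "\<And>u n. u \<in> carrier U \<Longrightarrow> n \<in> N \<Longrightarrow> act (f u) n \<in> D \<longleftrightarrow> n \<in> D"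
    and r_closed: "\<And>n. n \<in> N \<inter> D \<Longrightarrow> r n \<in> carrier Y"
    and r_mono: "\<And>m n. le m n \<Longrightarrow> m \<in> D \<Longrightarrow> (r m, r n) \<in> lleq Y"
    and r_act: "\<And>u n. u \<in> carrier U \<Longrightarrow> n \<in> N \<inter> D \<Longrightarrow> r (act (f u) n) = lact Y u (r n)"
    and r_j: "\<And>y. y \<in> carrier Y \<Longrightarrow> r (j y) = y"
  shows "order_embedding (tensor_carrier U X Y) (tensor_leq U X Y)
    (tensor_carrier U (tensor_ext U X f S) Y) (tensor_leq U (tensor_ext U X f S) Y)
    (poext_map U X f S Y)"
proof -
  let ?R = "restrict_left f S" and ?E = "tensor_ext U X f S"
  let ?T = "tensor_class U X ?R"
  interpret XY: tensor_pair U X Y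
    by (intro tensor_pair.intro U.pomonoid_axioms X.right_poset_axioms Y)
  interpret Y: left_poset U Y by (rule Y)
  interpret EY: tensor_pair U ?E Y
    by (intro tensor_pair.intro U.pomonoid_axioms right_poset_tensor_ext Y)
  have E: "carrier ?E = {?T x s | x s. x \<in> carrier X \<and> s \<in> carrier S}" "rleq ?E = tensor_leq U X ?R"
    by (auto simp: tensor_ext_def tensor_carrier_def)
  define G where "G = {((x, m), (x', n)). (m \<in> D \<longleftrightarrow> n \<in> D) \<and>
      (m \<in> D \<longrightarrow> ((x, r m), (x', r n)) \<in> tensor_preorder U X Y)}"
  have G_trans: "p \<in> G" if "(a, b) \<in> G" "(b, c) \<in> G" "p = (a, c)" for a b c p
    using that unfolding G_def by (auto dest: transD[OF XY.tensor_preorder_trans])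
  have G_le: "((x, m), (x', n)) \<in> G" if "(x, x') \<in> rleq X" "le m n" for x x' m n
    using that D_le[of m n] r_mono[of m n] by (auto simp: G_def XY.tensor_preorder_comp)
  have G_refl_le: "((x, m), (x, n)) \<in> G" if "x \<in> carrier X" "le m n" for x m n
    using that by (intro G_le XY.A_order(2))
  have G_move: "((ract X x u, n), (x, act (f u) n)) \<in> G" "((x, act (f u) n), (ract X x u, n)) \<in> G"
    if "x \<in> carrier X" "u \<in> carrier U" "n \<in> N" for x u n
    using that D_act[of u n] r_act[of u n] r_closed[of n] XY.tensor_preorder_move[of x "r n" u]
    by (auto simp: G_def)
  have S_closed: "s \<in> carrier S \<and> t \<in> carrier S" if "(s, t) \<in> leq S" for s t
    using that pomonoid_order(1)[OF S.pomonoid_axioms] by auto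
  have X_closed: "s \<in> carrier X \<and> t \<in> carrier X" if "(s, t) \<in> rleq X" for s t
    using that XY.A_order(1) by auto
  have step: "((x, act s n), (x', act s' n)) \<in> G"
    if le: "((x, s), (x', s')) \<in> tensor_preorder U X ?R" and n: "n \<in> N" for x s x' s' n
  proof -
    let ?g = "\<lambda>(x, s). (x, act s n)"
    have "(?g p, ?g q) \<in> G"
      if "(p, q) \<in> {((a, b), (a', b')). (a, a') \<in> rleq X \<and> (b, b') \<in> lleq ?R} \<union>
        tensor_gens U X ?R \<union> (tensor_gens U X ?R)\<inverse>" for p q
    proof -
      obtain x s x' s' where pq: "p = (x, s)" "q = (x', s')" by (metis surj_pair)
      from that consider "(x, x') \<in> rleq X" "(s, s') \<in> leq S"
        | "((x, s), (x', s')) \<in> tensor_gens U X ?R"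
        | "((x', s'), (x, s)) \<in> tensor_gens U X ?R" unfolding pq by auto
      then show ?thesis
      proof cases
        case 1
        then show ?thesis unfolding pq using n by (auto intro: G_le mono_left)
      next
        case 2
        then obtain u where u: "x' \<in> carrier X" "u \<in> carrier U" "s \<in> carrier S"
          "x = ract X x' u" "s' = f u \<otimes>\<^bsub>S\<^esub> s" by (auto simp: tensor_gens_def)
        then show ?thesis unfolding pq using n
          by (auto intro!: G_trans[OF G_move(1)[of x' u "act s n"] G_refl_le[of x']]
              simp: act_mult closed f_simps)
      next
        case 3
        then obtain u where "x \<in> carrier X" "u \<in> carrier U" "s' \<in> carrier S"
          "x' = ract X x u" "s = f u \<otimes>\<^bsub>S\<^esub> s'" by (auto simp: tensor_gens_def)
        then show ?thesis unfolding pq using n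
          by (auto intro!: G_trans[OF G_refl_le[of x] G_move(2)[of x u "act s' n"]]
              simp: act_mult closed f_simps)
      qed
    qed
    moreover have "Relation.trans G" by (rule transI) (auto intro: G_trans)
    ultimately show ?thesis
      using trancl_map[where g = ?g, OF le[unfolded tensor_preorder_def]] by simp
  qed
  \<comment> \<open>\<open>H\<close> pulls \<open>G\<close> back along \<open>x \<otimes> s \<otimes> y \<mapsto> x \<otimes> s (j y)\<close>. Demanding \<open>G\<close> for all
    representatives of the classes makes \<open>H\<close> depend on the classes only; transitivity then needs
    a representative of the middle class, which the carrier conditions provide.\<close>
  define H where "H = {((C, y), (C', y')). C \<in> carrier ?E \<and> C' \<in> carrier ?E \<and>
      (\<forall>x\<in>carrier X. \<forall>s\<in>carrier S. \<forall>x'\<in>carrier X. \<forall>s'\<in>carrier S.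
        C = ?T x s \<longrightarrow> C' = ?T x' s' \<longrightarrow> ((x, act s (j y)), (x', act s' (j y'))) \<in> G)}"
  have H_trans: "Relation.trans H"
  proof (rule transI)
    fix a b c assume "(a, b) \<in> H" "(b, c) \<in> H"
    moreover obtain A y B y' C y'' where "a = (A, y)" "b = (B, y')" "c = (C, y'')"
      by (metis surj_pair)
    ultimately show "(a, c) \<in> H"
      unfolding H_def E by clarsimp (blast intro: G_trans)
  qed
  have T_eq: "((x, act s (j y)), (x', act s' (j y))) \<in> G"
    if "(?T x s, ?T x' s') \<in> rleq ?E" "x \<in> carrier X" "s \<in> carrier S" "x' \<in> carrier X" "s' \<in> carrier S"
      "y \<in> carrier Y" for x s x' s' y
    using that j_closed[of y] by (intro step) (auto simp: E XS.tensor_leq_iff)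
  have H_gen: "((C, y), (C', y')) \<in> H" if C: "(C, C') \<in> rleq ?E" and y: "(y, y') \<in> lleq Y" for C C' y y'
  proof -
    have "((x, act s (j y)), (x', act s' (j y'))) \<in> G"
      if "x \<in> carrier X" "s \<in> carrier S" "x' \<in> carrier X" "s' \<in> carrier S"
        "C = ?T x s" "C' = ?T x' s'" for x s x' s'
      using that C y XY.B_order(1)
      by (auto intro!: G_trans[OF T_eq[of x s x' s' y] G_refl_le[of x']] mono j_mono)
    then show ?thesis
      using C EY.A_order(1) by (auto simp: H_def)
  qed
  have H_act: "((ract ?E C u, y), (C, lact Y u y)) \<in> H" "((C, lact Y u y), (ract ?E C u, y)) \<in> H"
    if C: "C \<in> carrier ?E" and u: "u \<in> carrier U" and y: "y \<in> carrier Y" for C u y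
  proof -
    have Cu: "ract ?E C u \<in> carrier ?E"
      using C u by (rule EY.A.act_closed)
    have *: "((x, act s (j y)), (x', act s' (j (lact Y u y)))) \<in> G \<and>
        ((x', act s' (j (lact Y u y))), (x, act s (j y))) \<in> G"
      if x: "x \<in> carrier X" "s \<in> carrier S" "x' \<in> carrier X" "s' \<in> carrier S"
        "ract ?E C u = ?T x s" "C = ?T x' s'" for x s x' s'
    proof -
      have su: "s' \<otimes>\<^bsub>S\<^esub> f u \<in> carrier S" using x u by (simp add: f_simps)
      have e: "?T x s = ?T x' (s' \<otimes>\<^bsub>S\<^esub> f u)"
        using x u by (simp add: tensor_ext_act flip: x(5))
      have r: "(?T x s, ?T x s) \<in> rleq ?E"
        using EY.A_order(2)[OF Cu] x by simp
      have a: "((x, act s (j y)), (x', act (s' \<otimes>\<^bsub>S\<^esub> f u) (j y))) \<in> G"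
        "((x', act (s' \<otimes>\<^bsub>S\<^esub> f u) (j y)), (x, act s (j y))) \<in> G"
        using T_eq[of x s x' "s' \<otimes>\<^bsub>S\<^esub> f u"] T_eq[of x' "s' \<otimes>\<^bsub>S\<^esub> f u" x s] r e su x y by auto
      have "le (act (s' \<otimes>\<^bsub>S\<^esub> f u) (j y)) (act s' (j (lact Y u y)))"
        "le (act s' (j (lact Y u y))) (act (s' \<otimes>\<^bsub>S\<^esub> f u) (j y))"
        using act_mult[of s' "f u" "j y"] j_closed[of y] j_act[OF u y] x u y
        by (auto simp: f_simps intro: trans mono)
      then show ?thesis
        using a G_refl_le[of x'] x by (blast intro: G_trans)
    qed
    from * C Cu show "((ract ?E C u, y), (C, lact Y u y)) \<in> H" "((C, lact Y u y), (ract ?E C u, y)) \<in> H"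
      by (auto simp: H_def)
  qed
  have reflect: "((x, y), (x', y')) \<in> tensor_preorder U X Y"
    if le: "((?T x \<one>\<^bsub>S\<^esub>, y), (?T x' \<one>\<^bsub>S\<^esub>, y')) \<in> tensor_preorder U ?E Y"
      and c: "x \<in> carrier X" "x' \<in> carrier X" "y \<in> carrier Y" "y' \<in> carrier Y" for x y x' y'
  proof -
    have "(p, q) \<in> H"
      if "(p, q) \<in> {((a, b), (a', b')). (a, a') \<in> rleq ?E \<and> (b, b') \<in> lleq Y} \<union>
        tensor_gens U ?E Y \<union> (tensor_gens U ?E Y)\<inverse>" for p q
      using that by (auto simp: tensor_gens_def H_gen H_act)
    \<comment> \<open>The generators of the tensor preorder lie in \<open>H\<close>, and \<open>H\<close> is transitive.\<close>
    from trancl_map[where g = "\<lambda>p. p", OF le[unfolded tensor_preorder_def] H_trans this]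
    have "((x, act \<one>\<^bsub>S\<^esub> (j y)), (x', act \<one>\<^bsub>S\<^esub> (j y'))) \<in> G"
      using c by (auto simp: H_def)
    moreover have "((x, j y), (x, act \<one>\<^bsub>S\<^esub> (j y))) \<in> G" "((x', act \<one>\<^bsub>S\<^esub> (j y')), (x', j y')) \<in> G"
      using c act_one[of "j y"] act_one[of "j y'"] j_closed[of y] j_closed[of y'] by (auto intro: G_refl_le)
    ultimately have "((x, j y), (x', j y')) \<in> G"
      using G_trans by metis
    then show ?thesis
      using c j_closed[of y] by (simp add: G_def r_j)
  qed
  have T1: "?T x \<one>\<^bsub>S\<^esub> \<in> carrier ?E" if "x \<in> carrier X" for x
    using that by (auto simp: E)
  show ?thesis
    unfolding order_embedding_def
  proof (intro conjI Pi_I ballI)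
    fix C assume "C \<in> tensor_carrier U X Y"
    then show "poext_map U X f S Y C \<in> tensor_carrier U ?E Y"
      using T1 poext_map_class[OF Y] by (fastforce simp: tensor_carrier_def)
  next
    fix C C' assume C: "C \<in> tensor_carrier U X Y" "C' \<in> tensor_carrier U X Y"
    then obtain x y x' y' where xy: "C = tensor_class U X Y x y" "C' = tensor_class U X Y x' y'"
      "x \<in> carrier X" "x' \<in> carrier X" "y \<in> carrier Y" "y' \<in> carrier Y"
      unfolding tensor_carrier_def by blast
    then show "(C, C') \<in> tensor_leq U X Y \<longleftrightarrow>
        (poext_map U X f S Y C, poext_map U X f S Y C') \<in> tensor_leq U ?E Y"
      using reflect tensor_unit_mono[OF Y]
      by (auto simp: poext_map_class[OF Y] XY.tensor_leq_iff EY.tensor_leq_iff T1)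
  qed
qed

section \<open>Letters from the two factors\<close>

lemma strongly_pounitaryD:
  assumes "strongly_pounitary V S" "s \<in> carrier S" "u \<in> V" "v \<in> V"
    and "(s \<otimes>\<^bsub>S\<^esub> u, v) \<in> leq S \<or> (v, s \<otimes>\<^bsub>S\<^esub> u) \<in> leq S \<or>
      (u \<otimes>\<^bsub>S\<^esub> s, v) \<in> leq S \<or> (v, u \<otimes>\<^bsub>S\<^esub> s) \<in> leq S"
  shows "s \<in> V"
  using assms
  unfolding strongly_pounitary_def strongly_right_pounitary_def strongly_left_pounitary_def
  by blast

locale pounitary_amalgam = pomonoid_amalgam U S1 S2 \<phi>1 \<phi>2
  for U :: "'u pomonoid" and S1 :: "'a pomonoid" and S2 :: "'b pomonoid"
    and \<phi>1 :: "'u \<Rightarrow> 'a" and \<phi>2 :: "'u \<Rightarrow> 'b" +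
  assumes pounitary1: "strongly_pounitary (\<phi>1 ` carrier U) S1"
    and pounitary2: "strongly_pounitary (\<phi>2 ` carrier U) S2"
begin

definition letters :: "('a + 'b) set" where
  "letters = carrier S1 <+> carrier S2"

text \<open>
  The two factors are treated uniformly: a letter carries its factor in \<open>isl\<close>, and \<open>U\<close> is embedded
  into the letters once for each value of \<open>isl\<close>.
\<close>
definition emb :: "bool \<Rightarrow> 'u \<Rightarrow> 'a + 'b" where
  "emb b u = (if b then Inl (\<phi>1 u) else Inr (\<phi>2 u))"

text \<open>Letters of different factors are never multiplied; the last clause only makes \<open>isl_lmult\<close> unconditional.\<close>
fun lmult :: "'a + 'b \<Rightarrow> 'a + 'b \<Rightarrow> 'a + 'b" where
  "lmult (Inl x) (Inl y) = Inl (x \<otimes>\<^bsub>S1\<^esub> y)"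
| "lmult (Inr x) (Inr y) = Inr (x \<otimes>\<^bsub>S2\<^esub> y)"
| "lmult k l = k"

inductive lle :: "'a + 'b \<Rightarrow> 'a + 'b \<Rightarrow> bool" where
  "(x, y) \<in> leq S1 \<Longrightarrow> lle (Inl x) (Inl y)"
| "(x, y) \<in> leq S2 \<Longrightarrow> lle (Inr x) (Inr y)"

definition inner :: "'a + 'b \<Rightarrow> bool" where
  "inner l \<longleftrightarrow> l \<in> emb (isl l) ` carrier U"

definition coord :: "'a + 'b \<Rightarrow> 'u" where
  "coord l = inv_into (carrier U) (emb (isl l)) l"

lemmas order1 = pomonoid_order[OF S1.pomonoid_axioms]
lemmas order2 = pomonoid_order[OF S2.pomonoid_axioms]
lemmas phi1 = pomonoid_homD[OF phi(1)]
lemmas phi2 = pomonoid_homD[OF phi(2)]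

lemma letters_simps [simp]:
  "Inl x \<in> letters \<longleftrightarrow> x \<in> carrier S1" "Inr y \<in> letters \<longleftrightarrow> y \<in> carrier S2"
  by (auto simp: letters_def)

lemma lle_simps [simp]:
  "lle (Inl x) (Inl x') \<longleftrightarrow> (x, x') \<in> leq S1" "lle (Inr y) (Inr y') \<longleftrightarrow> (y, y') \<in> leq S2"
  "\<not> lle (Inl x) (Inr y)" "\<not> lle (Inr y) (Inl x)"
  by (auto elim: lle.cases intro: lle.intros)

lemma isl_emb [simp]: "isl (emb b u) = b"
  by (simp add: emb_def)

lemma emb_letters [simp]: "u \<in> carrier U \<Longrightarrow> emb b u \<in> letters"
  by (simp add: emb_def phi1 phi2)

lemma isl_lmult [simp]: "isl (lmult k l) = isl k"
  by (cases "(k, l)" rule: lmult.cases) auto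

lemma lmult_letters [simp]:
  "k \<in> letters \<Longrightarrow> l \<in> letters \<Longrightarrow> isl k = isl l \<Longrightarrow> lmult k l \<in> letters"
  by (cases k; cases l) auto

lemma lmult_assoc:
  "k \<in> letters \<Longrightarrow> l \<in> letters \<Longrightarrow> m \<in> letters \<Longrightarrow> isl k = isl l \<Longrightarrow> isl l = isl m \<Longrightarrow>
    lmult (lmult k l) m = lmult k (lmult l m)"
  by (cases k; cases l; cases m) (auto simp: S1.m_assoc S2.m_assoc)

lemma lmult_one [simp]:
  "l \<in> letters \<Longrightarrow> b = isl l \<Longrightarrow> lmult (emb b \<one>\<^bsub>U\<^esub>) l = l"
  "l \<in> letters \<Longrightarrow> b = isl l \<Longrightarrow> lmult l (emb b \<one>\<^bsub>U\<^esub>) = l"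
  by (cases l; simp add: emb_def phi1 phi2)+

lemma emb_mult: "u \<in> carrier U \<Longrightarrow> v \<in> carrier U \<Longrightarrow>
    emb b (u \<otimes>\<^bsub>U\<^esub> v) = lmult (emb b u) (emb b v)"
  by (simp add: emb_def phi1 phi2)

lemma lle_letters: "lle k l \<Longrightarrow> k \<in> letters \<and> l \<in> letters \<and> isl k = isl l"
  using order1(1) order2(1) by (cases k; cases l) auto

lemma lle_refl: "l \<in> letters \<Longrightarrow> lle l l"
  by (cases l) (auto simp: order1 order2)

lemma lle_trans: "lle k l \<Longrightarrow> lle l m \<Longrightarrow> lle k m"
  by (cases k; cases l; cases m) (auto intro: order1(3) order2(3))

lemma lle_mult_right: "k \<in> letters \<Longrightarrow> isl k = isl l \<Longrightarrow> lle l m \<Longrightarrow> lle (lmult k l) (lmult k m)"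
  by (cases k; cases l; cases m) (auto intro: S1.mult_mono_right S2.mult_mono_right)

lemma lle_mult_left: "k \<in> letters \<Longrightarrow> isl k = isl l \<Longrightarrow> lle l m \<Longrightarrow> lle (lmult l k) (lmult m k)"
  by (cases k; cases l; cases m) (auto intro: S1.mult_mono_left S2.mult_mono_left)

lemma lle_emb: "u \<in> carrier U \<Longrightarrow> v \<in> carrier U \<Longrightarrow> lle (emb b u) (emb b v) \<longleftrightarrow> (u, v) \<in> leq U"
  using embedding1 embedding2
  by (auto simp: emb_def pomonoid_embedding_def order_embedding_def)

lemma inj_emb: "inj_on (emb b) (carrier U)"
proof (rule inj_onI)
  fix u v assume uv: "u \<in> carrier U" "v \<in> carrier U" "emb b u = emb b v"
  have "lle (emb b u) (emb b v)" "lle (emb b v) (emb b u)"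
    unfolding uv(3) using uv(2) by (simp_all add: lle_refl)
  then have "(u, v) \<in> leq U" "(v, u) \<in> leq U"
    using lle_emb[OF uv(1,2)] lle_emb[OF uv(2,1)] by blast+
  then show "u = v" by (rule pomonoid_order(4)[OF U.pomonoid_axioms])
qed

lemma inner_emb [simp]: "u \<in> carrier U \<Longrightarrow> inner (emb b u)"
  by (simp add: inner_def)

lemma coord_emb [simp]: "u \<in> carrier U \<Longrightarrow> coord (emb b u) = u"
  by (simp add: coord_def inj_emb)

lemma innerE:
  assumes "inner l"
  obtains b u where "u \<in> carrier U" "l = emb b u"
  using assms by (auto simp: inner_def)

lemma inner_simps:
  "inner (Inl x) \<longleftrightarrow> x \<in> \<phi>1 ` carrier U" "inner (Inr y) \<longleftrightarrow> y \<in> \<phi>2 ` carrier U"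
  by (auto simp: inner_def emb_def)

text \<open>
  The pounitarity assumptions enter only here. The lemmas \<open>inner_right\<close>, \<open>inner_left\<close> and \<open>inner_lle\<close>
  turn them into the decomposition of each factor into \<open>U\<close> and a complement that is closed
  under the two actions of \<open>U\<close> and under comparability.
\<close>
lemma inner_cancel:
  assumes "k \<in> letters" "u \<in> carrier U" "v \<in> carrier U"
    and "lle (lmult k (emb (isl k) u)) (emb (isl k) v) \<or> lle (emb (isl k) v) (lmult k (emb (isl k) u)) \<or>
      lle (lmult (emb (isl k) u) k) (emb (isl k) v) \<or> lle (emb (isl k) v) (lmult (emb (isl k) u) k)"
  shows "inner k"
proof (cases k)
  case (Inl x)
  then show ?thesis
    using assms strongly_pounitaryD[OF pounitary1, of x "\<phi>1 u" "\<phi>1 v"]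
    by (simp add: emb_def inner_simps)
next
  case (Inr y)
  then show ?thesis
    using assms strongly_pounitaryD[OF pounitary2, of y "\<phi>2 u" "\<phi>2 v"]
    by (simp add: emb_def inner_simps)
qed

lemma inner_right:
  assumes "k \<in> letters" "u \<in> carrier U" "b = isl k"
  shows "inner (lmult k (emb b u)) \<longleftrightarrow> inner k"
proof
  assume "inner (lmult k (emb b u))"
  then obtain v where "v \<in> carrier U" "lmult k (emb b u) = emb (isl k) v"
    by (auto simp: inner_def)
  then show "inner k"
    using assms by (intro inner_cancel[of k u v]) (simp_all add: lle_refl)
next
  assume "inner k"
  then obtain c v where "v \<in> carrier U" "k = emb c v"
    by (rule innerE)
  then show "inner (lmult k (emb b u))"
    using assms by (simp flip: emb_mult)
qed

lemma inner_left:
  assumes "k \<in> letters" "u \<in> carrier U" "b = isl k"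
  shows "inner (lmult (emb b u) k) \<longleftrightarrow> inner k"
proof
  assume "inner (lmult (emb b u) k)"
  then obtain v where "v \<in> carrier U" "lmult (emb b u) k = emb (isl k) v"
    using assms by (auto simp: inner_def)
  then show "inner k"
    using assms by (intro inner_cancel[of k u v]) (simp_all add: lle_refl)
next
  assume "inner k"
  then obtain c v where "v \<in> carrier U" "k = emb c v"
    by (rule innerE)
  then show "inner (lmult (emb b u) k)"
    using assms by (simp flip: emb_mult)
qed

lemma inner_lle:
  assumes "lle k l"
  shows "inner k \<longleftrightarrow> inner l"
proof -
  have kl: "k \<in> letters" "l \<in> letters" "isl k = isl l" using lle_letters[OF assms] by auto
  show ?thesis
  proof
    assume "inner k"
    then obtain b v where "v \<in> carrier U" "k = emb b v" by (rule innerE)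
    then show "inner l" using assms kl by (intro inner_cancel[of l "\<one>\<^bsub>U\<^esub>" v]) auto
  next
    assume "inner l"
    then obtain b v where "v \<in> carrier U" "l = emb b v" by (rule innerE)
    then show "inner k" using assms kl by (intro inner_cancel[of k "\<one>\<^bsub>U\<^esub>" v]) auto
  qed
qed

end

section \<open>Alternating tensor products\<close>

text \<open>
  \<open>Tensor l (Tensor k (Base y))\<close> stands for the element \<open>l \<otimes> k \<otimes> y\<close> of an iterated tensor product.
\<close>
datatype ('l, 'y) tower = Base 'y | Tensor 'l "('l, 'y) tower"

locale tower_act = pounitary_amalgam U S1 S2 \<phi>1 \<phi>2 + Y: left_poset U Y
  for U :: "'u pomonoid" and S1 :: "'a pomonoid" and S2 :: "'b pomonoid"
    and \<phi>1 :: "'u \<Rightarrow> 'a" and \<phi>2 :: "'u \<Rightarrow> 'b" and Y :: "('y, 'u) left_act_poset"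
begin

primrec starts :: "bool \<Rightarrow> ('a + 'b, 'y) tower \<Rightarrow> bool" where
  "starts b (Base y) = False"
| "starts b (Tensor l n) = (isl l = b)"

text \<open>The letters of a reduced tower lie outside \<open>U\<close> and alternate between the two factors.\<close>
primrec reduced :: "('a + 'b, 'y) tower \<Rightarrow> bool" where
  "reduced (Base y) = (y \<in> carrier Y)"
| "reduced (Tensor l n) = (l \<in> letters \<and> \<not> inner l \<and> \<not> starts (isl l) n \<and> reduced n)"

primrec uact :: "'u \<Rightarrow> ('a + 'b, 'y) tower \<Rightarrow> ('a + 'b, 'y) tower" where
  "uact u (Base y) = Base (lact Y u y)"
| "uact u (Tensor l n) = Tensor (lmult (emb (isl l) u) l) n"

text \<open>
  The order of the iterated tensor products. Each rule relates towers with the same sequence of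
  factors, so towers of different shape are incomparable; this is the disjointness of the union.
\<close>
inductive tle :: "('a + 'b, 'y) tower \<Rightarrow> ('a + 'b, 'y) tower \<Rightarrow> bool" where
  base: "(y, y') \<in> lleq Y \<Longrightarrow> tle (Base y) (Base y')"
| head: "lle l l' \<Longrightarrow> reduced (Tensor l n) \<Longrightarrow> tle (Tensor l n) (Tensor l' n)"
| tail: "tle n n' \<Longrightarrow> reduced (Tensor l n) \<Longrightarrow> tle (Tensor l n) (Tensor l n')"
| slide: "reduced (Tensor l n) \<Longrightarrow> u \<in> carrier U \<Longrightarrow>
    tle (Tensor (lmult l (emb (isl l) u)) n) (Tensor l (uact u n))"
| slide': "reduced (Tensor l n) \<Longrightarrow> u \<in> carrier U \<Longrightarrow>
    tle (Tensor l (uact u n)) (Tensor (lmult l (emb (isl l) u)) n)"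
| trans: "tle k m \<Longrightarrow> tle m n \<Longrightarrow> tle k n"

abbreviation equiv (infix "\<approx>" 50) where
  "m \<approx> n \<equiv> tle m n \<and> tle n m"

text \<open>
  The canonical map \<open>l \<otimes> n \<mapsto> l n\<close> from \<open>S\<^sub>i \<otimes> (N - N\<^sub>i)\<close> to \<open>N\<close>, for \<open>n\<close> not beginning in the
  factor of \<open>l\<close>. The lemmas \<open>cons_mono_left\<close>, \<open>cons_mono\<close> and \<open>cons_slide\<close> say that it is well
  defined on the tensor product.
\<close>
definition cons :: "'a + 'b \<Rightarrow> ('a + 'b, 'y) tower \<Rightarrow> ('a + 'b, 'y) tower" where
  "cons l n = (if inner l then uact (coord l) n else Tensor l n)"

text \<open>
  Multiplication of \<open>S\<^sub>i\<close> on the first factor of \<open>S\<^sub>i \<otimes> (N - N\<^sub>i)\<close>: a tower \<open>n\<close> that does not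
  begin in the factor of \<open>l\<close> is read as \<open>1 \<otimes> n\<close>.
\<close>
primrec act :: "'a + 'b \<Rightarrow> ('a + 'b, 'y) tower \<Rightarrow> ('a + 'b, 'y) tower" where
  "act l (Base y) = cons l (Base y)"
| "act l (Tensor k n) = (if isl k = isl l then cons (lmult l k) n else cons l (Tensor k n))"

lemma Y_order: "lleq Y \<subseteq> carrier Y \<times> carrier Y" "a \<in> carrier Y \<Longrightarrow> (a, a) \<in> lleq Y"
  "(a, b) \<in> lleq Y \<Longrightarrow> (b, c) \<in> lleq Y \<Longrightarrow> (a, c) \<in> lleq Y"
  "(a, b) \<in> lleq Y \<Longrightarrow> (b, a) \<in> lleq Y \<Longrightarrow> a = b"
  using Y.partial_order
  by (auto simp: partial_order_on_def preorder_on_def refl_on_def dest: transD antisymD)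

lemma starts_uact [simp]: "starts b (uact u n) = starts b n"
  by (cases n) auto

lemma reduced_uact [simp]: "u \<in> carrier U \<Longrightarrow> reduced n \<Longrightarrow> reduced (uact u n)"
  by (cases n) (auto simp: Y.act_closed inner_left)

lemma uact_one: "reduced n \<Longrightarrow> uact \<one>\<^bsub>U\<^esub> n = n"
  by (cases n) (auto simp: Y.act_one)

lemma uact_mult: "reduced n \<Longrightarrow> u \<in> carrier U \<Longrightarrow> v \<in> carrier U \<Longrightarrow>
    uact (u \<otimes>\<^bsub>U\<^esub> v) n = uact u (uact v n)"
  by (cases n) (auto simp: Y.act_mult emb_mult lmult_assoc)

lemma tle_refl: "reduced n \<Longrightarrow> tle n n"
  by (cases n) (auto intro: tle.base tle.head Y_order lle_refl)

lemma tle_reduced: "tle m n \<Longrightarrow> reduced m \<and> reduced n \<and> starts b m = starts b n"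
proof (induction arbitrary: b rule: tle.induct)
  case (base y y') then show ?case using Y_order(1) by auto
next
  case (head l l' n) then show ?case using lle_letters inner_lle by fastforce
qed (auto simp: inner_right)

lemma uact_mono: "tle m n \<Longrightarrow> u \<in> carrier U \<Longrightarrow> tle (uact u m) (uact u n)"
proof (induction rule: tle.induct)
  case (base y y') then show ?case by (auto intro: tle.base Y.act_mono_right)
next
  case (head l l' n) then show ?case
    using lle_letters[OF head(1)] by (auto intro!: tle.head lle_mult_right simp: inner_left)
next
  case (tail n n' l) then show ?case by (auto intro!: tle.tail simp: inner_left)
next
  case (slide l n v) then show ?case
    using tle.slide[of "lmult (emb (isl l) u) l" n v] by (simp add: inner_left lmult_assoc)
next
  case (slide' l n v) then show ?case
    using tle.slide'[of "lmult (emb (isl l) u) l" n v] by (simp add: inner_left lmult_assoc)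
qed (blast intro: tle.trans)

lemma uact_mono_left: "(u, v) \<in> leq U \<Longrightarrow> reduced n \<Longrightarrow> tle (uact u n) (uact v n)"
  using pomonoid_order(1)[OF U.pomonoid_axioms]
  by (cases n) (auto intro!: tle.base tle.head Y.act_mono_left lle_mult_left simp: inner_left lle_emb)

lemma cons_emb: "u \<in> carrier U \<Longrightarrow> cons (emb b u) n = uact u n"
  by (simp add: cons_def)

lemma cons_reduced:
  assumes "l \<in> letters" "reduced n" "\<not> starts (isl l) n"
  shows "reduced (cons l n)"
  using assms by (auto simp: cons_def elim!: innerE)

lemma cons_mono_left:
  assumes "lle k l" "reduced n" "\<not> starts (isl l) n"
  shows "tle (cons k n) (cons l n)"
proof (cases "inner k")
  case True
  then obtain b u where u: "u \<in> carrier U" "k = emb b u" by (rule innerE)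
  have "inner l" using True inner_lle[OF assms(1)] by simp
  then obtain c v where v: "v \<in> carrier U" "l = emb c v" by (rule innerE)
  have "c = b" using lle_letters[OF assms(1)] u v by simp
  with u v show ?thesis
    using assms by (simp add: cons_emb lle_emb uact_mono_left)
next
  case False
  then show ?thesis
    using assms lle_letters[OF assms(1)] inner_lle[OF assms(1)] by (simp add: cons_def tle.head)
qed

lemma cons_mono:
  assumes "l \<in> letters" "\<not> starts (isl l) m" "tle m n"
  shows "tle (cons l m) (cons l n)"
proof (cases "inner l")
  case True
  then show ?thesis using assms by (metis innerE cons_emb uact_mono)
next
  case False
  then show ?thesis using assms tle_reduced[OF assms(3)] by (auto simp: cons_def intro: tle.tail)
qed

lemma cons_slide:
  assumes "l \<in> letters" "\<not> starts b n" "reduced n" "u \<in> carrier U" "b = isl l"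
  shows "cons (lmult l (emb b u)) n \<approx> cons l (uact u n)"
proof (cases "inner l")
  case True
  then obtain c v where v: "v \<in> carrier U" "l = emb c v" by (rule innerE)
  then have "cons (lmult l (emb b u)) n = cons l (uact u n)"
    using assms cons_emb[of "v \<otimes>\<^bsub>U\<^esub> u" b n] by (simp add: emb_mult cons_emb uact_mult)
  moreover have "reduced (cons l (uact u n))"
    using assms by (intro cons_reduced) simp_all
  ultimately show ?thesis by (simp add: tle_refl)
next
  case False
  then show ?thesis using assms by (simp add: cons_def inner_right tle.slide tle.slide')
qed

lemma act_not_starts: "\<not> starts (isl l) n \<Longrightarrow> act l n = cons l n"
  by (cases n) auto

text \<open>
  The action of \<open>U\<close> does not depend on the factor through which it is taken; this lets the two
  actions factor through the amalgamated free product.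
\<close>
lemma act_emb: "u \<in> carrier U \<Longrightarrow> reduced n \<Longrightarrow> act (emb b u) n = uact u n"
  by (cases n) (auto simp: cons_emb, auto simp: cons_def inner_left)

lemma act_reduced: "l \<in> letters \<Longrightarrow> reduced n \<Longrightarrow> reduced (act l n)"
  by (cases n) (auto intro!: cons_reduced)

lemma act_mono: "tle m n \<Longrightarrow> s \<in> letters \<Longrightarrow> tle (act s m) (act s n)"
proof (induction rule: tle.induct)
  case (base y y') then show ?case by (auto intro: cons_mono tle.base)
next
  case (head l l' n) then show ?case
    using lle_letters[OF head(1)]
    by (auto intro!: cons_mono cons_mono_left lle_mult_right tle.head)
next
  case (tail n n' l) then show ?case by (auto intro!: cons_mono tle.tail)
next
  case (slide l n u) then show ?case
    using cons_slide[of "lmult s l" "isl l" n u] tle.slide[of l n u]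
    by (auto simp: lmult_assoc intro!: cons_mono)
next
  case (slide' l n u) then show ?case
    using cons_slide[of "lmult s l" "isl l" n u] tle.slide'[of l n u]
    by (auto simp: lmult_assoc intro!: cons_mono)
qed (blast intro: tle.trans)

lemma act_mono_left: "lle s t \<Longrightarrow> reduced n \<Longrightarrow> tle (act s n) (act t n)"
  using lle_letters[of s t] by (cases n) (auto intro!: cons_mono_left lle_mult_left)

text \<open>
  If \<open>l\<close> lies in \<open>U\<close>, then \<open>cons l n\<close> has absorbed \<open>l\<close> into \<open>n\<close>, and \<open>cons_slide\<close> brings it back
  next to \<open>s\<close>. Since that holds up to equivalence only, so does associativity of the action.
\<close>
lemma act_cons:
  assumes "s \<in> letters" "l \<in> letters" "isl s = isl l" "\<not> starts (isl l) n" "reduced n"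
  shows "act s (cons l n) \<approx> cons (lmult s l) n"
proof (cases "inner l")
  case True
  then obtain b u where u: "u \<in> carrier U" "l = emb b u" by (rule innerE)
  then have "act s (cons l n) = cons s (uact u n)"
    using assms by (simp add: cons_emb act_not_starts)
  then show ?thesis using assms u cons_slide[of s "isl s" n u] by simp
next
  case False
  then show ?thesis using assms by (simp add: cons_def[of l] tle_refl cons_reduced)
qed

lemma act_mult:
  assumes "s \<in> letters" "t \<in> letters" "isl s = isl t" "reduced n"
  shows "act s (act t n) \<approx> act (lmult s t) n"
proof (cases "starts (isl t) n")
  case True
  then obtain k m where n: "n = Tensor k m" "isl k = isl t" by (cases n) auto
  then show ?thesis
    using assms act_cons[of s "lmult t k" m] by (simp add: lmult_assoc)
next
  case False
  then show ?thesis using assms act_cons[of s t n] by (simp add: act_not_starts)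
qed

section \<open>The action of the free product\<close>

definition wact :: "('a + 'b) list \<Rightarrow> ('a + 'b, 'y) tower \<Rightarrow> ('a + 'b, 'y) tower" where
  "wact w n = foldr act w n"

lemma wact_simps [simp]:
  "wact [] n = n" "wact (l # w) n = act l (wact w n)" "wact (v @ w) n = wact v (wact w n)"
  by (simp_all add: wact_def)

lemma words_letters: "words = lists letters"
  by (simp add: words_def letters_def)

lemma wact_reduced: "w \<in> words \<Longrightarrow> reduced n \<Longrightarrow> reduced (wact w n)"
  unfolding words_letters by (induction w) (auto intro: act_reduced)

lemma wact_mono: "w \<in> words \<Longrightarrow> tle m n \<Longrightarrow> tle (wact w m) (wact w n)"
  unfolding words_letters by (induction w) (auto intro: act_mono)

lemma wact_rel: "word_rel v w \<Longrightarrow> reduced n \<Longrightarrow> wact v n \<approx> wact w n"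
proof (induction rule: word_rel.induct)
  case (mult1 x y) then show ?case using act_mult[of "Inl x" "Inl y" n] by simp
next
  case (mult2 x y) then show ?case using act_mult[of "Inr x" "Inr y" n] by simp
next
  case one1
  then show ?case using act_emb[of "\<one>\<^bsub>U\<^esub>" n True] by (simp add: emb_def phi1 uact_one tle_refl)
next
  case one2
  then show ?case using act_emb[of "\<one>\<^bsub>U\<^esub>" n False] by (simp add: emb_def phi2 uact_one tle_refl)
next
  case (amalg u)
  then show ?case using act_emb[of u n True] act_emb[of u n False]
    by (simp add: emb_def tle_refl)
qed

text \<open>
  The defining relations of the free product hold for the action, so words that are related in the
  free product act in the same relation. Everything about the free product below comes from here.
\<close>
lemma wact_mono_left: "word_leq v w \<Longrightarrow> reduced n \<Longrightarrow> tle (wact v n) (wact w n)"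
proof (induction arbitrary: n rule: word_leq.induct)
  case (append v w v' w')
  then show ?case
    using word_leq_words[of v w] word_leq_words[of v' w']
    by (auto intro!: tle.trans[OF wact_mono append.IH(1)] wact_reduced)
qed (auto simp: tle_refl wact_reduced wact_rel intro: tle.trans act_mono_left lle.intros)

lemma tle_Base: "tle m n \<Longrightarrow> m = Base y \<Longrightarrow> \<exists>y'. n = Base y' \<and> (y, y') \<in> lleq Y"
  by (induction arbitrary: y rule: tle.induct) (auto, metis Y_order(3))

lemma tle_is_Base: "tle m n \<Longrightarrow> m \<in> range Base \<longleftrightarrow> n \<in> range Base"
  by (induction rule: tle.induct) auto

lemma equiv_Base: "n \<approx> Base y \<Longrightarrow> n = Base y"
  using tle_is_Base[of n "Base y"] tle_Base[of n "Base y"] tle_Base[of "Base y" n y] Y_order(4) by auto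

text \<open>
  The monoid \<open>P\<close> acts through \<open>h\<close> and a choice of words; different choices act equivalently.
  The criterion applies with the towers that have no letter as the summand.
\<close>
lemma order_embedding_poext_map_amalgam:
  assumes "scalar_ext U P X f" and h: "h \<in> pomonoid_hom P free_product"
    and hf: "\<And>u. u \<in> carrier U \<Longrightarrow> h (f u) = inj1 (\<phi>1 u)"
  shows "order_embedding (tensor_carrier U X Y) (tensor_leq U X Y)
    (tensor_carrier U (tensor_ext U X f P) Y) (tensor_leq U (tensor_ext U X f P) Y)
    (poext_map U X f P Y)"
proof -
  interpret scalar_ext U P X f by fact
  define rep where "rep p = (SOME w. w \<in> words \<and> word_class w = h p)" for p
  have rep: "rep p \<in> words" "word_class (rep p) = h p" if "p \<in> carrier P" for p
  proof -
    have "\<exists>w. w \<in> words \<and> word_class w = h p"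
      using pomonoid_homD(1)[OF h that] by (auto simp: free_product_simps)
    from someI_ex[OF this] show "rep p \<in> words" "word_class (rep p) = h p" by (simp_all add: rep_def)
  qed
  have rep_eq: "wact (rep p) n \<approx> wact w n"
    if "p \<in> carrier P" "w \<in> words" "h p = word_class w" "reduced n" for p w n
    using that rep[of p] word_class_eq_iff[of "rep p" w] wact_mono_left by auto
  have rep_f: "wact (rep (f u)) n \<approx> uact u n" if "u \<in> carrier U" "reduced n" for u n
    using rep_eq[of "f u" "[emb True u]" n] that hf[of u] act_emb[of u n True]
    by (simp add: f_simps inj1_def emb_def phi1)
  show ?thesis
  proof (rule order_embedding_poext_map[where le = tle and act = "\<lambda>p. wact (rep p)"
        and N = "{n. reduced n}" and D = "range Base" and j = Base
        and r = "\<lambda>n. case n of Base y \<Rightarrow> y"])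
    show "left_poset U Y" by (rule Y.left_poset_axioms)
    show "tle (wact (rep s) n) (wact (rep t) n)" if "(s, t) \<in> leq P" "n \<in> {n. reduced n}" for s t n
    proof (rule wact_mono_left)
      have "s \<in> carrier P" "t \<in> carrier P" using that(1) pomonoid_order(1)[OF S.pomonoid_axioms] by auto
      then show "word_leq (rep s) (rep t)"
        using pomonoid_homD(4)[OF h that(1)] by (simp add: rep free_product_leq flip: rep(2))
    qed (use that in simp)
    show "wact (rep (s \<otimes>\<^bsub>P\<^esub> t)) n \<approx> wact (rep s) (wact (rep t) n)"
      if "s \<in> carrier P" "t \<in> carrier P" "n \<in> {n. reduced n}" for s t n
      using that rep_eq[of "s \<otimes>\<^bsub>P\<^esub> t" "rep s @ rep t" n]
      by (simp add: rep pomonoid_homD(2)[OF h] flip: free_product_mult)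
    show "wact (rep \<one>\<^bsub>P\<^esub>) n \<approx> n" if "n \<in> {n. reduced n}" for n
      using that rep_eq[of "\<one>\<^bsub>P\<^esub>" "[]" n]
      by (simp add: pomonoid_homD(3)[OF h] free_product_simps)
    show "Base (lact Y u y) \<approx> wact (rep (f u)) (Base y)" if "u \<in> carrier U" "y \<in> carrier Y" for u y
      using that rep_f[of u "Base y"] by simp
    show "wact (rep (f u)) n \<in> range Base \<longleftrightarrow> n \<in> range Base"
      if "u \<in> carrier U" "n \<in> {n. reduced n}" for u n
      using that tle_is_Base[of "wact (rep (f u)) n" "uact u n"] rep_f[of u n] by (cases n) auto
    show "(case wact (rep (f u)) n of Base y \<Rightarrow> y) = lact Y u (case n of Base y \<Rightarrow> y)"
      if "u \<in> carrier U" "n \<in> {n. reduced n} \<inter> range Base" for u n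
      using that rep_f[of u n] equiv_Base by fastforce
    show "(case m of Base y \<Rightarrow> y, case n of Base y \<Rightarrow> y) \<in> lleq Y" if "tle m n" "m \<in> range Base" for m n
      using that tle_Base[of m n] by (elim imageE) fastforce
  qed (auto simp: rep wact_reduced wact_mono tle_is_Base intro: tle.base tle.trans)
qed

end

section \<open>The factors inside the free product\<close>

context pounitary_amalgam
begin

lemma left_poset_self: "left_poset U (restrict_left id U)"
  using U.one_closed U.partial_order
  by unfold_locales
    (auto simp: restrict_left_def U.m_assoc intro: U.mult_mono_left U.mult_mono_right)

interpretation T: tower_act U S1 S2 \<phi>1 \<phi>2 "restrict_left id U"
  by (intro tower_act.intro pounitary_amalgam_axioms left_poset_self)

text \<open>
  On towers over \<open>U\<close> with at most one letter, taken from a fixed factor, multiplying out is the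
  isomorphism \<open>U \<union> (A\<^sub>i \<otimes> U) \<cong> S\<^sub>i\<close>. It recovers a letter from its action on the unit.
\<close>
primrec val :: "bool \<Rightarrow> ('a + 'b, 'u) tower \<Rightarrow> 'a + 'b" where
  "val b (Base u) = emb b u"
| "val b (Tensor l n) = lmult l (val b n)"

primrec shallow :: "bool \<Rightarrow> ('a + 'b, 'u) tower \<Rightarrow> bool" where
  "shallow b (Base u) = True"
| "shallow b (Tensor l n) = (isl l = b \<and> n \<in> range Base)"

lemma self_simps: "carrier (restrict_left id U) = carrier U" "lleq (restrict_left id U) = leq U"
  "lact (restrict_left id U) u v = u \<otimes>\<^bsub>U\<^esub> v"
  by (simp_all add: restrict_left_def)

lemma val_mono: "T.tle m n \<Longrightarrow> (shallow b m \<longleftrightarrow> shallow b n) \<and> (shallow b m \<longrightarrow> lle (val b m) (val b n))"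
proof (induction rule: T.tle.induct)
  case (base y y')
  then show ?case
    using pomonoid_order(1)[OF U.pomonoid_axioms] by (auto simp: self_simps lle_emb)
next
  case (head l l' n)
  then show ?case using lle_letters[OF head(1)] by (auto simp: self_simps intro!: lle_mult_left)
next
  case (tail n n' l)
  then show ?case using T.tle_is_Base[OF tail(1)] by (auto intro!: lle_mult_right)
next
  case (slide l n u)
  then show ?case by (cases n) (auto simp: self_simps lmult_assoc emb_mult intro!: lle_refl)
next
  case (slide' l n u)
  then show ?case by (cases n) (auto simp: self_simps lmult_assoc emb_mult intro!: lle_refl)
next
  case (trans k m n)
  then show ?case by (blast intro: lle_trans)
qed

lemma letter_act_unit:
  assumes "l \<in> letters"
  shows "shallow (isl l) (T.act l (Base \<one>\<^bsub>U\<^esub>)) \<and> val (isl l) (T.act l (Base \<one>\<^bsub>U\<^esub>)) = l \<and>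
    (T.starts b (T.act l (Base \<one>\<^bsub>U\<^esub>)) \<longleftrightarrow> \<not> inner l \<and> isl l = b)"
proof (cases "inner l")
  case True
  then obtain c u where u: "u \<in> carrier U" "l = emb c u" by (rule innerE)
  then have "T.act l (Base \<one>\<^bsub>U\<^esub>) = Base u"
    by (simp add: T.cons_emb self_simps)
  with u show ?thesis by simp
next
  case False
  with assms show ?thesis by (simp add: T.cons_def)
qed

lemma word_leq_act_unit:
  assumes "word_leq [k] [l]"
  shows "T.tle (T.act k (Base \<one>\<^bsub>U\<^esub>)) (T.act l (Base \<one>\<^bsub>U\<^esub>))"
  using T.wact_mono_left[OF assms, of "Base \<one>\<^bsub>U\<^esub>"] by (simp add: self_simps)

lemma word_leq_letter:
  assumes "word_leq [k] [l]" "isl k = isl l"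
  shows "lle k l"
proof -
  have "k \<in> letters" "l \<in> letters"
    using word_leq_words[OF assms(1)] by (auto simp: T.words_letters)
  then show ?thesis
    using val_mono[OF word_leq_act_unit[OF assms(1)], of "isl k"] assms(2)
      letter_act_unit[of k] letter_act_unit[of l] by simp
qed

text \<open>
  A letter outside \<open>U\<close> sends the unit to a tower beginning in its own factor, and comparable towers
  begin in the same factor.
\<close>
lemma word_leq_letter_inner:
  assumes "word_leq [k] [l]" "isl k \<noteq> isl l"
  shows "inner k"
proof -
  have "k \<in> letters" "l \<in> letters"
    using word_leq_words[OF assms(1)] by (auto simp: T.words_letters)
  then show ?thesis
    using T.tle_reduced[OF word_leq_act_unit[OF assms(1)], of "isl k"] assms(2)
      letter_act_unit[of k "isl k"] letter_act_unit[of l "isl k"] by simp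
qed

lemma inj1_le: "x \<in> carrier S1 \<Longrightarrow> y \<in> carrier S1 \<Longrightarrow>
    (inj1 x, inj1 y) \<in> leq free_product \<longleftrightarrow> (x, y) \<in> leq S1"
  using word_leq_letter[of "Inl x" "Inl y"] word_leq.mono1[of x y] by (auto simp: inj1_def free_product_leq)

lemma inj2_le: "x \<in> carrier S2 \<Longrightarrow> y \<in> carrier S2 \<Longrightarrow>
    (inj2 x, inj2 y) \<in> leq free_product \<longleftrightarrow> (x, y) \<in> leq S2"
  using word_leq_letter[of "Inr x" "Inr y"] word_leq.mono2[of x y] by (auto simp: inj2_def free_product_leq)

theorem strongly_poembeddable_amalgam: "strongly_poembeddable U S1 S2 \<phi>1 \<phi>2"
proof -
  have "pomonoid_embedding S1 free_product inj1" "pomonoid_embedding S2 free_product inj2"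
    using inj1_hom inj2_hom
    by (auto simp: pomonoid_embedding_def order_embedding_def pomonoid_hom_def hom_def inj1_le inj2_le)
  moreover have "inj1 ` carrier S1 \<inter> inj2 ` carrier S2 = inj1 ` \<phi>1 ` carrier U"
  proof (intro equalityI subsetI)
    fix c assume "c \<in> inj1 ` carrier S1 \<inter> inj2 ` carrier S2"
    then obtain x y where xy: "c = inj1 x" "inj1 x = inj2 y" "x \<in> carrier S1" "y \<in> carrier S2" by auto
    then have "word_leq [Inl x] [Inr y]"
      by (simp add: inj1_def inj2_def word_class_eq_iff)
    then have "inner (Inl x)" by (rule word_leq_letter_inner) simp
    then show "c \<in> inj1 ` \<phi>1 ` carrier U" using xy by (auto simp: inner_simps)
  next
    fix c assume "c \<in> inj1 ` \<phi>1 ` carrier U"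
    then show "c \<in> inj1 ` carrier S1 \<inter> inj2 ` carrier S2"
      using inj_amalg phi1(1) phi2(1) by force
  qed
  ultimately show ?thesis
    unfolding strongly_poembeddable_def strongly_poembeddable_in_def
    using pomonoid_free_product inj_amalg
    by (intro exI[of _ free_product] exI[of _ inj1] exI[of _ inj2] conjI ballI)
qed

theorem poextension_property_free_product:
  fixes P :: "'p pomonoid"
  assumes "amalgamated_free_product U S1 S2 \<phi>1 \<phi>2 P \<iota>1 \<iota>2"
  shows "poextension_property TYPE('x) TYPE('y) U (\<iota>1 \<circ> \<phi>1) P"
proof -
  have push: "pushout_wrt TYPE(('a + 'b) list set) U S1 S2 \<phi>1 \<phi>2 P \<iota>1 \<iota>2"
    using assms by (simp add: amalgamated_free_product_def)
  then have P: "pomonoid P" and i: "\<iota>1 \<in> pomonoid_hom S1 P" by (auto simp: pushout_wrt_def)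
  obtain h where h: "h \<in> pomonoid_hom P free_product" "\<And>x. x \<in> carrier S1 \<Longrightarrow> h (\<iota>1 x) = inj1 x"
    using pushout_wrtE[OF push pomonoid_free_product inj1_hom inj2_hom inj_amalg] by metis
  let ?f = "\<iota>1 \<circ> \<phi>1"
  have hom: "?f \<in> pomonoid_hom U P" using phi(1) i by (rule pomonoid_hom_comp)
  have "(u, v) \<in> leq U" if "u \<in> carrier U" "v \<in> carrier U" "(?f u, ?f v) \<in> leq P" for u v
    using pomonoid_homD(4)[OF h(1) that(3)] that lle_emb[of u v True] by (simp add: h phi1 inj1_le emb_def)
  then have "pomonoid_embedding U P ?f"
    using hom by (auto simp: pomonoid_embedding_def order_embedding_def pomonoid_hom_def hom_def)
  moreover have "order_embedding (tensor_carrier U X Y) (tensor_leq U X Y)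
      (tensor_carrier U (tensor_ext U X ?f P) Y) (tensor_leq U (tensor_ext U X ?f P) Y)
      (poext_map U X ?f P Y)" if "right_poset U X" "left_poset U Y"
    for X :: "('x, 'u) right_act_poset" and Y :: "('y, 'u) left_act_poset"
  proof -
    interpret Y: tower_act U S1 S2 \<phi>1 \<phi>2 Y
      by (intro tower_act.intro pounitary_amalgam_axioms that)
    have "scalar_ext U P X ?f"
      by (intro scalar_ext.intro scalar_ext_axioms.intro U.pomonoid_axioms P that hom)
    then show ?thesis
      using h(1) by (rule Y.order_embedding_poext_map_amalgam) (simp add: h phi1)
  qed
  ultimately show ?thesis by (simp add: poextension_property_def)
qed

end

theorem theorem3p6:
  fixes U :: "'u pomonoid" and S1 :: "'a pomonoid" and S2 :: "'b pomonoid"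
    and \<phi>1 :: "'u \<Rightarrow> 'a" and \<phi>2 :: "'u \<Rightarrow> 'b"
  assumes "pomonoid_amalgam U S1 S2 \<phi>1 \<phi>2"
    and "strongly_pounitary (\<phi>1 ` carrier U) S1"
    and "strongly_pounitary (\<phi>2 ` carrier U) S2"
  shows "strongly_poembeddable U S1 S2 \<phi>1 \<phi>2 \<and>
    (\<forall>(P :: 'p pomonoid) \<iota>1 \<iota>2.
       amalgamated_free_product U S1 S2 \<phi>1 \<phi>2 P \<iota>1 \<iota>2 \<longrightarrow>
       poextension_property TYPE('x) TYPE('y) U (\<iota>1 \<circ> \<phi>1) P)"
proof -
  interpret pounitary_amalgam U S1 S2 \<phi>1 \<phi>2
    using assms by (intro pounitary_amalgam.intro pounitary_amalgam_axioms.intro)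
  show ?thesis using strongly_poembeddable_amalgam poextension_property_free_product by blast
qed

end
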